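(* Let $T$ be an $\mathbb R$-tree. Then $\widehat T^{\mathrm{obs}}$ is Hausdorff. Moreover, if $T$ is separable, then $\widehat T^{\mathrm{obs}}$ is separable and compact.
   Context: An $\mathbb R$-tree $T$ is a metric space in which any two points $P,Q$ are joined by a unique arc $[P,Q]$, and this arc is geodesic (isometric to an interval of $\mathbb R$). $\overline T$ is its metric completion (again an $\mathbb R$-tree), $\partial T$ its Gromov boundary (rays $\mathbb R_{\ge 0}\to T$, two rays being identified iff their images differ only in a compact subset of $T$), and $\widehat T=\overline T\cup\partial T$. For $P,Q\in\widehat T$, $[P,Q]\subset\widehat T$ is the (possibly infinite or bi-infinite) geodesic arc joining $P$ to $Q$, endpoints included. The metric topology on $\widehat T$ restricts to the metric topology on the open subset $\overline T$, and a neighborhood basis of a point of $\partial T$ represented by a ray $\rho$ is given by the connected components of $\widehat T\smallsetminus\{P\}$, $P\in T$, having non-compact intersection with the image of $\rho$. For distinct $P,Q\in\widehat T$, the direction $\mathrm{dir}_P(Q)$ is the connected component of $\widehat T\smallsetminus\{P\}$ containing $Q$ (i.e. the set of $R\neq P$ with $P\notin[Q,R]$). The observers' topology on $\widehat T$ is the topology having the set of all directions as a subbasis; $\widehat T^{\mathrm{obs}}$ denotes $\widehat T$ with this topology. *)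

theory Defs
  imports "HOL-Analysis.Analysis"
begin

section \<open>Real trees\<close>

definition isometric_on :: "real set \<Rightarrow> 'a metric \<Rightarrow> (real \<Rightarrow> 'a) \<Rightarrow> bool" where
  "isometric_on J T g \<longleftrightarrow>
     g ` J \<subseteq> mspace T \<and> (\<forall>s\<in>J. \<forall>t\<in>J. mdist T (g s) (g t) = \<bar>s - t\<bar>)"

text \<open>
  Arcs are regarded as subsets. The case \<open>r = 0\<close> gives the degenerate arc from a point to
  itself, which is then the only arc with these end points.
\<close>
definition arc_between :: "'a topology \<Rightarrow> 'a \<Rightarrow> 'a \<Rightarrow> 'a set \<Rightarrow> bool" where
  "arc_between X P Q A \<longleftrightarrow>
     (\<exists>r g. 0 \<le> r \<and> embedding_map (subtopology euclideanreal {0..r}) X g \<and>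
            g 0 = P \<and> g r = Q \<and> g ` {0..r} = A)"

definition geodesic_set :: "'a metric \<Rightarrow> 'a set \<Rightarrow> bool" where
  "geodesic_set T A \<longleftrightarrow> (\<exists>J g. is_interval J \<and> isometric_on J T g \<and> g ` J = A)"

definition real_tree :: "'a metric \<Rightarrow> bool" where
  "real_tree T \<longleftrightarrow>
     (\<forall>P\<in>mspace T. \<forall>Q\<in>mspace T.
        (\<exists>!A. arc_between (mtopology_of T) P Q A) \<and>
        (\<forall>A. arc_between (mtopology_of T) P Q A \<longrightarrow> geodesic_set T A))"


section \<open>Metric completion and Gromov boundary\<close>

text \<open>
  A metric completion is determined up to a unique isometry over \<open>T\<close>; we work with an arbitrary
  one, \<open>i\<close> being the inclusion of \<open>T\<close> into it.
\<close>
definition metric_completion_of :: "'a metric \<Rightarrow> 'b metric \<Rightarrow> ('a \<Rightarrow> 'b) \<Rightarrow> bool" where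
  "metric_completion_of T Tbar i \<longleftrightarrow>
     mcomplete_of Tbar \<and>
     i \<in> mspace T \<rightarrow> mspace Tbar \<and>
     (\<forall>x\<in>mspace T. \<forall>y\<in>mspace T. mdist Tbar (i x) (i y) = mdist T x y) \<and>
     mtopology_of Tbar closure_of (i ` mspace T) = mspace Tbar"

lemma metric_completion_exists:
  fixes T :: "'a metric"
  shows "\<exists>(Tbar :: ('a \<Rightarrow> real) metric) i. metric_completion_of T Tbar i"
  unfolding metric_completion_of_def
  by (metis Metric_space.metric_completion Metric_space_mspace_mdist)

text \<open>
  Only the values of a ray on \<open>{0..}\<close> matter. Equivalence depends on the images alone, so the
  arbitrary values at negative arguments do not affect the set of equivalence classes.
\<close>
definition rays :: "'a metric \<Rightarrow> (real \<Rightarrow> 'a) set" where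
  "rays T = {\<rho>. isometric_on {0..} T \<rho>}"

definition ray_equiv :: "'a metric \<Rightarrow> ((real \<Rightarrow> 'a) \<times> (real \<Rightarrow> 'a)) set" where
  "ray_equiv T =
     {(\<rho>, \<sigma>). \<rho> \<in> rays T \<and> \<sigma> \<in> rays T \<and>
        (\<exists>K. compactin (mtopology_of T) K \<and>
             (\<rho> ` {0..} - \<sigma> ` {0..}) \<union> (\<sigma> ` {0..} - \<rho> ` {0..}) \<subseteq> K)}"

definition gromov_boundary :: "'a metric \<Rightarrow> (real \<Rightarrow> 'a) set set" where
  "gromov_boundary T = rays T // ray_equiv T"

definition hat :: "'a metric \<Rightarrow> 'b metric \<Rightarrow> ('b + (real \<Rightarrow> 'a) set) set" where
  "hat T Tbar = mspace Tbar <+> gromov_boundary T"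


section \<open>The metric topology and the observers' topology\<close>

text \<open>
  The whole set \<open>U\<close> is always open, even if \<open>\<B>\<close> does not cover it (as for a one-point tree,
  which has no directions).
\<close>
definition topology_with_subbasis :: "'c set \<Rightarrow> 'c set set \<Rightarrow> 'c topology" where
  "topology_with_subbasis U \<B> =
     topology (arbitrary union_of (finite intersection_of (\<lambda>S. S \<in> \<B>) relative_to U))"

text \<open>
  The neighbourhoods of a boundary point are connected components of the complement of a point
  \<open>P\<close> of \<open>T\<close> in \<open>hat T Tbar\<close>. To avoid referring to the topology that is being defined, such a
  component is described as a component \<open>C\<close> of the complement of \<open>P\<close> in the completion together
  with all boundary points whose rays have non-compact intersection with \<open>C\<close>. Here
  ``non-compact'' has to mean ``not contained in a compact set'': if \<open>P\<close> lies on the ray at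
  time \<open>s > 0\<close>, the component containing the initial piece \<open>\<rho> ` {0..<s}\<close> must not count, although
  that piece is not closed in the completion.
\<close>
definition hat_component ::
  "'a metric \<Rightarrow> 'b metric \<Rightarrow> ('a \<Rightarrow> 'b) \<Rightarrow> 'b set \<Rightarrow> ('b + (real \<Rightarrow> 'a) set) set" where
  "hat_component T Tbar i C =
     C <+> {\<xi> \<in> gromov_boundary T. \<exists>\<rho>\<in>\<xi>.
              \<not> (\<exists>K. compactin (mtopology_of Tbar) K \<and> i ` \<rho> ` {0..} \<inter> C \<subseteq> K)}"

text \<open>The generating family is a basis when \<open>T\<close> is a real tree.\<close>
definition hat_metric_topology ::
  "'a metric \<Rightarrow> 'b metric \<Rightarrow> ('a \<Rightarrow> 'b) \<Rightarrow> ('b + (real \<Rightarrow> 'a) set) topology" where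
  "hat_metric_topology T Tbar i =
     topology_with_subbasis (hat T Tbar)
       ({Inl ` V | V. openin (mtopology_of Tbar) V} \<union>
        {hat_component T Tbar i C | P C. P \<in> mspace T \<and>
           C \<in> connected_components_of
                 (subtopology (mtopology_of Tbar) (mspace Tbar - {i P}))})"

definition direction ::
  "'a metric \<Rightarrow> 'b metric \<Rightarrow> ('a \<Rightarrow> 'b) \<Rightarrow>
     'b + (real \<Rightarrow> 'a) set \<Rightarrow> 'b + (real \<Rightarrow> 'a) set \<Rightarrow> ('b + (real \<Rightarrow> 'a) set) set" where
  "direction T Tbar i P Q =
     connected_component_of_set
       (subtopology (hat_metric_topology T Tbar i) (hat T Tbar - {P})) Q"

definition observers_topology ::
  "'a metric \<Rightarrow> 'b metric \<Rightarrow> ('a \<Rightarrow> 'b) \<Rightarrow> ('b + (real \<Rightarrow> 'a) set) topology" where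
  "observers_topology T Tbar i =
     topology_with_subbasis (hat T Tbar)
       {direction T Tbar i P Q | P Q. P \<in> hat T Tbar \<and> Q \<in> hat T Tbar \<and> P \<noteq> Q}"

end

(*
Fix a base point b of T. Every point R of hat T Tbar is determined by the geodesic from b to R, and
two such geodesics agree on an initial interval. For P different from Q, the direction of Q at P is
the set of R whose geodesic does not pass through P if that of Q does not, and otherwise the set of R
whose geodesic agrees with that of Q beyond P. These sets are open and connected in the metric
topology and partition the complement of P, so they are its components.

Two points are separated by a point at which their geodesics have already branched. For compactness,
take a cover by directions and consider the points P for which the
direction of b at P is in the cover. If two of them are not on a common geodesic from b, their two
directions of b already cover everything. Otherwise they form a chain, whose supremum exists by
completeness; it can only be covered by a direction pointing away from b, and that direction together
with one of the directions of b covers everything. The observers' topology is coarser than the metric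
one, so a countable dense subset of T stays dense.
*)
theory Submission
  imports Defs
begin

section \<open>Geodesics in real trees\<close>

text \<open>Uniqueness of arcs does not pass to a completion by taking limits. It is therefore
  replaced by the hyperbolicity inequality for the Gromov product at \<open>b\<close>,
  \<open>min (gp x y) (gp y z) \<le> gp x z\<close>. In \<open>T\<close> it expresses that "agreeing
  up to time \<open>t\<close>" is transitive among geodesics from \<open>b\<close>; being a closed
  condition, it survives in \<open>Tbar\<close>. No arcs of \<open>Tbar\<close> are studied: only
  the geodesics from \<open>b\<close> and the times up to which they agree. Boundary points fit the
  same pattern, since each class of rays contains exactly one ray from \<open>b\<close>, up to its
  values at negative times.

  The second obstacle is that two kinds of components occur: those in the completion that generate
  the metric topology, and those in \<open>hat T Tbar\<close> that are the directions. Both are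
  compared with the sets \<open>dirn P Q\<close>, which are defined from geodesics alone. After
  that, separation and compactness become statements about the tree order rooted at
  \<open>b\<close>.\<close>

lemma openin_mtopology_of_iff:
  "openin (mtopology_of m) U \<longleftrightarrow>
     U \<subseteq> mspace m \<and> (\<forall>x\<in>U. \<exists>r>0. \<forall>y\<in>mspace m. mdist m x y < r \<longrightarrow> y \<in> U)"
proof -
  interpret Metric_space "mspace m" "mdist m" by (rule Metric_space_mspace_mdist)
  show ?thesis
    unfolding mtopology_of_def openin_mtopology subset_iff in_mball by blast
qed

text \<open>Isometry would be too strong an assumption: a path that follows one geodesic and then
  another is at first only known to be 1-Lipschitz.\<close>

lemma nonexpansive_imp_continuous_map:
  assumes "\<And>s. s \<in> J \<Longrightarrow> g s \<in> mspace m"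
    and "\<And>s t. s \<in> J \<Longrightarrow> t \<in> J \<Longrightarrow> mdist m (g s) (g t) \<le> \<bar>s - t\<bar>"
  shows "continuous_map (top_of_set J) (mtopology_of m) g"
  unfolding continuous_map_def
proof (intro conjI allI impI)
  show "g \<in> topspace (top_of_set J) \<rightarrow> topspace (mtopology_of m)"
    using assms by auto
next
  fix U assume U: "openin (mtopology_of m) U"
  have "\<exists>e>0. \<forall>t\<in>J. dist t s < e \<longrightarrow> g t \<in> U" if "s \<in> J" "g s \<in> U" for s
  proof -
    obtain r where "r > 0" "\<forall>y\<in>mspace m. mdist m (g s) y < r \<longrightarrow> y \<in> U"
      using U \<open>g s \<in> U\<close> unfolding openin_mtopology_of_iff by blast
    moreover have "mdist m (g s) (g t) < r" if "t \<in> J" "dist t s < r" for t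
      using assms(2)[OF \<open>s \<in> J\<close> \<open>t \<in> J\<close>] that by (simp add: dist_real_def)
    ultimately show ?thesis
      using assms(1) by blast
  qed
  then show "openin (top_of_set J) {x \<in> topspace (top_of_set J). g x \<in> U}"
    unfolding openin_euclidean_subtopology_iff by auto
qed

lemma isometric_on_imp_continuous_map:
  assumes "isometric_on J m g"
  shows "continuous_map (top_of_set J) (mtopology_of m) g"
  using assms unfolding isometric_on_def by (intro nonexpansive_imp_continuous_map) auto

lemma isometric_on_subset: "isometric_on J m g \<Longrightarrow> K \<subseteq> J \<Longrightarrow> isometric_on K m g"
  unfolding isometric_on_def by blast

lemma isometric_on_connectedin:
  assumes "isometric_on J m g" "is_interval K" "K \<subseteq> J"
  shows "connectedin (mtopology_of m) (g ` K)"
proof -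
  have "connectedin (top_of_set J) K"
    using assms(2,3) by (simp add: connectedin_subtopology is_interval_connected_1)
  then show ?thesis
    by (rule connectedin_continuous_map_image[OF isometric_on_imp_continuous_map[OF assms(1)]])
qed

lemma isometric_on_compactin:
  assumes "isometric_on J m g" "compact K" "K \<subseteq> J"
  shows "compactin (mtopology_of m) (g ` K)"
proof -
  have "compactin (top_of_set J) K"
    using assms(2,3) by (simp add: compactin_subtopology)
  then show ?thesis
    by (rule image_compactin[OF _ isometric_on_imp_continuous_map[OF assms(1)]])
qed

text \<open>A continuous injection from a compact space to a Hausdorff space is closed, hence an
  embedding.\<close>

lemma arc_between_image:
  fixes g :: "real \<Rightarrow> 'a"
  assumes "0 \<le> r" "inj_on g {0..r}"
    and "continuous_map (top_of_set {0..r}) (mtopology_of m) g"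
  shows "arc_between (mtopology_of m) (g 0) (g r) (g ` {0..r})"
proof -
  interpret Metric_space "mspace m" "mdist m" by (rule Metric_space_mspace_mdist)
  have "embedding_map (top_of_set {0..r}) (mtopology_of m) g"
  proof (rule injective_closed_imp_embedding_map[OF assms(3)])
    show "closed_map (top_of_set {0..r}) (mtopology_of m) g"
      by (rule continuous_imp_closed_map[OF assms(3) compact_space_subtopology])
        (simp_all add: mtopology_of_def Hausdorff_space_mtopology)
  qed (use assms in simp)
  then show ?thesis
    unfolding arc_between_def using assms(1) by blast
qed

lemma isometric_on_arc:
  assumes "isometric_on {0..r} m g" "0 \<le> r"
  shows "arc_between (mtopology_of m) (g 0) (g r) (g ` {0..r})"
proof (rule arc_between_image)
  show "inj_on g {0..r}"
  proof (rule inj_onI)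
    fix s t assume "s \<in> {0..r}" "t \<in> {0..r}" "g s = g t"
    then have "mdist m (g s) (g t) = \<bar>s - t\<bar>" "g s \<in> mspace m"
      using assms(1) unfolding isometric_on_def by blast+
    then show "s = t"
      using \<open>g s = g t\<close> Metric_space.mdist_zero[OF Metric_space_mspace_mdist] by fastforce
  qed
qed (use assms isometric_on_imp_continuous_map in auto)

section \<open>Unique geodesics and their branch points\<close>

context
  fixes T :: "'a metric"
  assumes tree: "real_tree T"
begin

lemma real_tree_arc_unique:
  assumes "arc_between (mtopology_of T) P Q A" "arc_between (mtopology_of T) P Q B"
    "P \<in> mspace T" "Q \<in> mspace T"
  shows "A = B"
  using tree assms unfolding real_tree_def by blast

lemma real_tree_geodesic:
  assumes "P \<in> mspace T" "Q \<in> mspace T"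
  obtains g where "isometric_on {0..mdist T P Q} T g" "g 0 = P" "g (mdist T P Q) = Q"
proof -
  obtain A where A: "arc_between (mtopology_of T) P Q A"
    using tree assms unfolding real_tree_def by blast
  then have "geodesic_set T A"
    using tree assms unfolding real_tree_def by blast
  then obtain J h where J: "is_interval J" "isometric_on J T h" "h ` J = A"
    unfolding geodesic_set_def by blast
  have "P \<in> A" "Q \<in> A"
    using A unfolding arc_between_def by force+
  then obtain u v where uv: "u \<in> J" "v \<in> J" "h u = P" "h v = Q"
    using J(3) by blast
  have d: "mdist T P Q = \<bar>u - v\<bar>"
    using J(2) uv unfolding isometric_on_def by blast
  \<comment> \<open>The interval that parametrizes the arc may lie anywhere and run in either
    direction; \<open>\<epsilon>\<close> reverses it when \<open>Q\<close> comes first.\<close>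
  define \<epsilon> :: real where "\<epsilon> = (if u \<le> v then 1 else - 1)"
  define g where "g s = h (u + \<epsilon> * s)" for s
  have mem: "u + \<epsilon> * s \<in> J" if "s \<in> {0..mdist T P Q}" for s
    using mem_is_interval_1_I[OF J(1) uv(1,2), of "u + \<epsilon> * s"]
      mem_is_interval_1_I[OF J(1) uv(2,1), of "u + \<epsilon> * s"] that
    unfolding d \<epsilon>_def by (auto split: if_splits)
  have "isometric_on {0..mdist T P Q} T g"
    using J(2) mem unfolding isometric_on_def g_def \<epsilon>_def
    by (auto simp: image_subset_iff abs_minus_commute)
  moreover have "g 0 = P" "g (mdist T P Q) = Q"
    using uv by (auto simp: g_def d \<epsilon>_def)
  ultimately show ?thesis
    using that by blast
qed

text \<open>Arcs are sets, so their uniqueness only equates the images. The distance from the common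
  starting point then identifies the parameters.\<close>

lemma real_tree_geodesic_unique:
  assumes "isometric_on {0..r} T g" "isometric_on {0..r} T h" "g 0 = h 0" "g r = h r"
    "s \<in> {0..r}"
  shows "g s = h s"
proof -
  have "0 \<le> r" using assms by auto
  have "g 0 \<in> mspace T" "g r \<in> mspace T"
    using assms unfolding isometric_on_def by auto
  then have "g ` {0..r} = h ` {0..r}"
    using real_tree_arc_unique isometric_on_arc[OF assms(1) \<open>0 \<le> r\<close>]
      isometric_on_arc[OF assms(2) \<open>0 \<le> r\<close>] assms by metis
  then obtain t where t: "t \<in> {0..r}" "g s = h t"
    using assms(5) by blast
  have "mdist T (g 0) (g s) = \<bar>0 - s\<bar>" "mdist T (h 0) (h t) = \<bar>0 - t\<bar>"
    using assms(1,2,5) t(1) unfolding isometric_on_def by force+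
  then have "s = t"
    using assms(3,5) t by simp
  then show ?thesis using t by simp
qed

text \<open>
  Following the first geodesic back from \<open>x\<close> to the branch point and then the second one to \<open>y\<close>
  gives an arc, so the branch point lies on the geodesic from \<open>x\<close> to \<open>y\<close>.
\<close>
lemma real_tree_geodesics_agree_iff:
  assumes "isometric_on {0..p} T g" "isometric_on {0..q} T h" "g 0 = h 0"
    "0 \<le> t" "t \<le> p" "t \<le> q"
  shows "g t = h t \<longleftrightarrow> t \<le> (p + q - mdist T (g p) (h q)) / 2"
proof -
  interpret Metric_space "mspace T" "mdist T" by (rule Metric_space_mspace_mdist)
  have g: "g s \<in> mspace T" if "s \<in> {0..p}" for s
    using assms(1) that unfolding isometric_on_def by auto
  have h: "h s \<in> mspace T" if "s \<in> {0..q}" for s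
    using assms(2) that unfolding isometric_on_def by auto
  have gd: "mdist T (g s) (g s') = \<bar>s - s'\<bar>" if "s \<in> {0..p}" "s' \<in> {0..p}" for s s'
    using assms(1) that unfolding isometric_on_def by auto
  have hd: "mdist T (h s) (h s') = \<bar>s - s'\<bar>" if "s \<in> {0..q}" "s' \<in> {0..q}" for s s'
    using assms(2) that unfolding isometric_on_def by auto
  define E where "E = {s \<in> {0..min p q}. g s = h s}"
  have "0 \<in> E" "bdd_above E"
    using assms unfolding E_def by (auto intro: bdd_aboveI[of _ p])
  define c where "c = Sup E"
  have c: "0 \<le> c" "c \<le> p" "c \<le> q" "\<And>s. s \<in> E \<Longrightarrow> s \<le> c"
  proof -
    show "\<And>s. s \<in> E \<Longrightarrow> s \<le> c"
      unfolding c_def using \<open>bdd_above E\<close> by (rule cSup_upper[rotated])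
    show "0 \<le> c"
      unfolding c_def using \<open>0 \<in> E\<close> \<open>bdd_above E\<close> by (rule cSup_upper)
    show "c \<le> p" "c \<le> q"
      unfolding c_def using \<open>0 \<in> E\<close> by (auto intro!: cSup_least simp: E_def)
  qed
  \<comment> \<open>The supremum is attained: both geodesics have unit speed, so a gap of
    \<open>2 * e\<close> at time \<open>c\<close> would leave them apart at every common time in the
    interval from \<open>c - e\<close> to \<open>c\<close>.\<close>
  have "g c = h c"
  proof (rule ccontr)
    assume "g c \<noteq> h c"
    then have pos: "mdist T (g c) (h c) > 0"
      using c g h by auto
    define e where "e = mdist T (g c) (h c) / 2"
    have "c - e < c" using pos unfolding e_def by simp
    then obtain s where s: "s \<in> E" "c - e < s"
      using less_cSupE[of "c - e" E] \<open>0 \<in> E\<close> unfolding c_def by blast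
    have "s \<le> c" using s c by blast
    have "mdist T (g c) (h c) \<le> mdist T (g c) (g s) + mdist T (h s) (h c)"
      using triangle[of "g c" "g s" "h c"] s c g h unfolding E_def by auto
    also have "\<dots> = (c - s) + (c - s)"
      using s c \<open>s \<le> c\<close> unfolding E_def by (subst gd, simp, simp, subst hd, auto)
    also have "\<dots> < 2 * e" using s by simp
    finally show False unfolding e_def by simp
  qed
  have below: "g s = h s" if "0 \<le> s" "s \<le> c" for s
    by (rule real_tree_geodesic_unique[of c])
      (use that c assms \<open>g c = h c\<close> in \<open>auto intro: isometric_on_subset\<close>)
  have agree: "g s = h s \<longleftrightarrow> s \<le> c" if "0 \<le> s" "s \<le> p" "s \<le> q" for s
    using below c(4)[of s] that unfolding E_def by auto
  define r where "r = (p - c) + (q - c)"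
  \<comment> \<open>Back along \<open>g\<close> from \<open>g p\<close> to the branch point, reached
    at time \<open>p - c\<close>, then forward along \<open>h\<close>.\<close>
  define f where "f s = (if s \<le> p - c then g (p - s) else h (s - (p - c) + c))" for s
  have r: "0 \<le> r" "p - c \<le> r" using c unfolding r_def by auto
  have f_in: "f s \<in> mspace T" if "s \<in> {0..r}" for s
    using that c unfolding f_def r_def by (auto intro!: g h)
  have f_ends: "f 0 = g p" "f r = h q"
  proof -
    show "f 0 = g p" using c unfolding f_def by auto
    show "f r = h q"
      using c \<open>g c = h c\<close> unfolding f_def r_def by (cases "q = c") (auto simp: algebra_simps)
  qed
  have f_le: "mdist T (f s) (f s') \<le> s' - s" if "s \<in> {0..r}" "s' \<in> {0..r}" "s \<le> s'" for s s'
  proof -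
    consider "s' \<le> p - c" | "p - c < s" | "s \<le> p - c" "p - c < s'" by linarith
    then show ?thesis
    proof cases
      case 1 then show ?thesis
        using that c unfolding f_def by (auto simp: gd)
    next
      case 2 then show ?thesis
        using that c unfolding f_def r_def by (auto simp: hd)
    next
      case 3
      have "mdist T (f s) (f s') \<le> mdist T (f s) (g c) + mdist T (h c) (f s')"
        using triangle[of "f s" "g c" "f s'"] that f_in c \<open>g c = h c\<close> g[of c] by auto
      also have "\<dots> = (p - s - c) + (s' - (p - c))"
        using 3 c that unfolding f_def r_def by (auto simp: gd hd)
      finally show ?thesis by simp
    qed
  qed
  have "continuous_map (top_of_set {0..r}) (mtopology_of T) f"
  proof (rule nonexpansive_imp_continuous_map)
    show "mdist T (f s) (f t) \<le> \<bar>s - t\<bar>" if "s \<in> {0..r}" "t \<in> {0..r}" for s t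
      using f_le[of s t] f_le[of t s] that by (auto simp: commute abs_real_def)
  qed (use f_in in auto)
  moreover have "inj_on f {0..r}"
  proof (rule linorder_inj_onI)
    fix s s' assume s: "s < s'" "s \<in> {0..r}" "s' \<in> {0..r}"
    consider "s' \<le> p - c" | "p - c < s" | "s \<le> p - c" "p - c < s'" by linarith
    then show "f s \<noteq> f s'"
    proof cases
      case 1
      then have "mdist T (f s) (f s') = s' - s"
        using s c unfolding f_def by (auto simp: gd)
      then show ?thesis using s f_in[of s] by auto
    next
      case 2
      then have "mdist T (f s) (f s') = s' - s"
        using s c unfolding f_def r_def by (auto simp: hd)
      then show ?thesis using s f_in[of s] by auto
    next
      case 3
      define u where "u = p - s"
      define v where "v = s' - (p - c) + c"
      have uv: "c \<le> u" "u \<le> p" "c < v" "v \<le> q" "f s = g u" "f s' = h v"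
        using 3 s c unfolding u_def v_def f_def r_def by auto
      \<comment> \<open>A coincidence between the two halves would be at equal distance from the
        common start, hence an agreement of \<open>g\<close> and \<open>h\<close> later than
        \<open>c\<close>.\<close>
      show ?thesis
      proof
        assume "f s = f s'"
        moreover have "mdist T (g 0) (g u) = u" "mdist T (h 0) (h v) = v"
          using uv c by (auto simp: gd hd)
        ultimately have "u = v" using uv assms(3) by simp
        then have "u \<le> c"
          using agree[of u] \<open>f s = f s'\<close> uv c by auto
        then show False using uv \<open>u = v\<close> by simp
      qed
    qed
  qed auto
  ultimately have arc: "arc_between (mtopology_of T) (g p) (h q) (f ` {0..r})"
    using arc_between_image[OF r(1)] f_ends by metis
  define D where "D = mdist T (g p) (h q)"
  obtain k where k: "isometric_on {0..D} T k" "k 0 = g p" "k D = h q"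
    using real_tree_geodesic[of "g p" "h q"] g[of p] h[of q] c unfolding D_def by auto
  have "0 \<le> D" unfolding D_def by simp
  \<comment> \<open>The geodesic from \<open>g p\<close> to \<open>h q\<close> has the same image as
    this arc, so it passes through \<open>g c\<close>. Hence \<open>D\<close> is the sum of
    \<open>p - c\<close> and \<open>q - c\<close>, which determines \<open>c\<close>.\<close>
  have "k ` {0..D} = f ` {0..r}"
    using real_tree_arc_unique[OF _ arc] isometric_on_arc[OF k(1) \<open>0 \<le> D\<close>] k
      g[of p] h[of q] c by auto
  moreover have "f (p - c) = g c" unfolding f_def by simp
  ultimately obtain s where s: "s \<in> {0..D}" "k s = g c"
    using r c by (metis atLeastAtMost_iff diff_ge_0_iff_ge imageE imageI)
  have "mdist T (g p) (g c) = s" "mdist T (g c) (h q) = D - s"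
    using k(1) s \<open>0 \<le> D\<close> unfolding isometric_on_def k(2,3)[symmetric] by (force simp flip: s(2))+
  moreover have "mdist T (g p) (g c) = p - c" "mdist T (g c) (h q) = q - c"
    using gd[of p c] hd[of c q] c \<open>g c = h c\<close> by simp_all
  ultimately have "c = (p + q - D) / 2" by simp
  then show ?thesis
    using agree[OF assms(4-6)] unfolding D_def by linarith
qed

end


section \<open>The completion and the boundary seen from a base point\<close>

lemma equiv_ray_equiv: "equiv (rays T) (ray_equiv T)"
proof (rule equivI)
  show "ray_equiv T \<subseteq> rays T \<times> rays T"
    unfolding ray_equiv_def by auto
  show "refl_on (rays T) (ray_equiv T)"
    unfolding refl_on_def ray_equiv_def by (auto intro: exI[of _ "{}"])
  show "sym (ray_equiv T)"
    unfolding sym_def ray_equiv_def by (auto simp: Un_commute)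
  show "trans (ray_equiv T)"
  proof (rule transI)
    fix \<rho> \<sigma> \<tau> assume "(\<rho>, \<sigma>) \<in> ray_equiv T" "(\<sigma>, \<tau>) \<in> ray_equiv T"
    then obtain K L where "\<rho> \<in> rays T" "\<tau> \<in> rays T"
      and K: "compactin (mtopology_of T) K"
        "(\<rho> ` {0..} - \<sigma> ` {0..}) \<union> (\<sigma> ` {0..} - \<rho> ` {0..}) \<subseteq> K"
      and L: "compactin (mtopology_of T) L"
        "(\<sigma> ` {0..} - \<tau> ` {0..}) \<union> (\<tau> ` {0..} - \<sigma> ` {0..}) \<subseteq> L"
      unfolding ray_equiv_def by auto
    moreover have "(\<rho> ` {0..} - \<tau> ` {0..}) \<union> (\<tau> ` {0..} - \<rho> ` {0..}) \<subseteq> K \<union> L"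
      using K(2) L(2) by blast
    ultimately show "(\<rho>, \<tau>) \<in> ray_equiv T"
      unfolding ray_equiv_def using compactin_Un[OF K(1) L(1)] by blast
  qed
qed

text \<open>The base point is chosen in \<open>T\<close>, where \<open>real_tree\<close> provides
  the geodesics that leave it.\<close>

locale completed_tree =
  fixes T :: "'a metric" and Tbar :: "'b metric" and i :: "'a \<Rightarrow> 'b" and b :: 'a
  assumes tree: "real_tree T" and compl: "metric_completion_of T Tbar i"
    and base: "b \<in> mspace T"
begin

sublocale B: Metric_space "mspace Tbar" "mdist Tbar"
  by (rule Metric_space_mspace_mdist)

abbreviation M :: "'b set" where "M \<equiv> mspace Tbar"
abbreviation d :: "'b \<Rightarrow> 'b \<Rightarrow> real" where "d \<equiv> mdist Tbar"
abbreviation nm :: "'b \<Rightarrow> real" where "nm \<equiv> d (i b)"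

text \<open>The Gromov product with respect to the base point.\<close>
definition gp :: "'b \<Rightarrow> 'b \<Rightarrow> real" where
  "gp x y = (nm x + nm y - d x y) / 2"

lemma i_in [simp]: "x \<in> mspace T \<Longrightarrow> i x \<in> M"
  using compl unfolding metric_completion_of_def by blast

lemma i_dist [simp]: "x \<in> mspace T \<Longrightarrow> y \<in> mspace T \<Longrightarrow> d (i x) (i y) = mdist T x y"
  using compl unfolding metric_completion_of_def by blast

lemma i_base_in: "i b \<in> M"
  using base by simp

lemma i_inj: "x \<in> mspace T \<Longrightarrow> y \<in> mspace T \<Longrightarrow> i x = i y \<longleftrightarrow> x = y"
  by (metis i_dist Metric_space.zero Metric_space_mspace_mdist)

lemma dense:
  assumes "x \<in> M" "0 < e"
  obtains y where "y \<in> mspace T" "d x (i y) < e"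
proof -
  have "x \<in> B.mtopology closure_of (i ` mspace T)"
    using compl assms unfolding metric_completion_of_def mtopology_of_def by simp
  then show ?thesis
    using assms that unfolding B.metric_closure_of by auto
qed

lemma isometric_on_i: "isometric_on J T g \<Longrightarrow> isometric_on J Tbar (i \<circ> g)"
  unfolding isometric_on_def by (auto simp: image_subset_iff)

section \<open>The Gromov product and segments in the completion\<close>

lemma gp_commute: "gp x y = gp y x"
  unfolding gp_def by (simp add: B.commute)

lemma gp_nonneg: "x \<in> M \<Longrightarrow> y \<in> M \<Longrightarrow> 0 \<le> gp x y"
  unfolding gp_def using B.triangle[of x "i b" y] i_base_in B.commute[of x "i b"] by simp

lemma gp_le: "x \<in> M \<Longrightarrow> y \<in> M \<Longrightarrow> gp x y \<le> nm x"
  unfolding gp_def using B.triangle[of "i b" x y] i_base_in by simp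

lemma gp_ge: "x \<in> M \<Longrightarrow> y \<in> M \<Longrightarrow> nm x - d x y \<le> gp x y"
  unfolding gp_def using B.triangle[of "i b" y x] i_base_in B.commute[of x y] by simp

text \<open>In \<open>T\<close> the Gromov product is the time at which two geodesics from
  \<open>b\<close> branch. If the geodesics to \<open>x\<close> and \<open>y\<close> agree at time
  \<open>t\<close>, and those to \<open>y\<close> and \<open>z\<close> too, then so do those to
  \<open>x\<close> and \<open>z\<close>.\<close>

lemma gp_ultrametric_T:
  assumes "x \<in> mspace T" "y \<in> mspace T" "z \<in> mspace T"
  shows "min (gp (i x) (i y)) (gp (i y) (i z)) \<le> gp (i x) (i z)"
proof -
  define t where "t = min (gp (i x) (i y)) (gp (i y) (i z))"
  obtain f where f: "isometric_on {0..mdist T b x} T f" "f 0 = b" "f (mdist T b x) = x"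
    using real_tree_geodesic[OF tree base assms(1)] .
  obtain g where g: "isometric_on {0..mdist T b y} T g" "g 0 = b" "g (mdist T b y) = y"
    using real_tree_geodesic[OF tree base assms(2)] .
  obtain h where h: "isometric_on {0..mdist T b z} T h" "h 0 = b" "h (mdist T b z) = z"
    using real_tree_geodesic[OF tree base assms(3)] .
  have t: "0 \<le> t" "t \<le> mdist T b x" "t \<le> mdist T b y" "t \<le> mdist T b z"
    using gp_nonneg[of "i x" "i y"] gp_nonneg[of "i y" "i z"] gp_le[of "i x" "i y"]
      gp_le[of "i y" "i z"] gp_le[of "i z" "i y"] assms base
    unfolding t_def by (auto simp: gp_commute)
  have le: "t \<le> gp (i x) (i y)" "t \<le> gp (i y) (i z)"
    unfolding t_def by auto
  have "f t = g t"
    using real_tree_geodesics_agree_iff[OF tree f(1) g(1), of t] f(2,3) g(2,3) t le assms base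
    unfolding gp_def by simp
  moreover have "g t = h t"
    using real_tree_geodesics_agree_iff[OF tree g(1) h(1), of t] h(2,3) g(2,3) t le assms base
    unfolding gp_def by simp
  ultimately have "t \<le> gp (i x) (i z)"
    using real_tree_geodesics_agree_iff[OF tree f(1) h(1), of t] f(2,3) h(2,3) t assms base
    unfolding gp_def by simp
  then show ?thesis unfolding t_def .
qed

text \<open>The Lipschitz bound by which inequalities between Gromov products pass to
  limits.\<close>

lemma gp_approx:
  assumes "x \<in> M" "y \<in> M" "x' \<in> M" "y' \<in> M"
  shows "\<bar>gp x y - gp x' y'\<bar> \<le> d x x' + d y y'"
proof -
  have "\<bar>nm x - nm x'\<bar> \<le> d x x'" "\<bar>nm y - nm y'\<bar> \<le> d y y'"
    using B.triangle[of "i b" x x'] B.triangle[of "i b" x' x] B.commute[of x x']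
      B.triangle[of "i b" y y'] B.triangle[of "i b" y' y] B.commute[of y y'] assms i_base_in
    by auto
  moreover have "\<bar>d x y - d x' y'\<bar> \<le> d x x' + d y y'"
    using B.triangle[of x x' y] B.triangle[of x' y' y] B.triangle[of x' x y'] B.triangle[of x y y']
      B.commute[of x x'] B.commute[of y y'] assms by auto
  ultimately show ?thesis
    unfolding gp_def abs_le_iff by (simp add: field_simps)
qed

lemma gp_ultrametric:
  assumes "x \<in> M" "y \<in> M" "z \<in> M"
  shows "min (gp x y) (gp y z) \<le> gp x z"
proof (rule field_le_epsilon)
  fix e :: real assume "0 < e"
  \<comment> \<open>Each product involves two approximated points and moves by at most
    \<open>e / 2\<close>; one product on either side of the inequality changes, which costs
    \<open>e\<close> in total.\<close>
  then have e: "0 < e / 4" by simp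
  obtain x' where x': "x' \<in> mspace T" "d x (i x') < e / 4" using dense[OF assms(1) e] .
  obtain y' where y': "y' \<in> mspace T" "d y (i y') < e / 4" using dense[OF assms(2) e] .
  obtain z' where z': "z' \<in> mspace T" "d z (i z') < e / 4" using dense[OF assms(3) e] .
  have "\<bar>gp x y - gp (i x') (i y')\<bar> \<le> e / 2" "\<bar>gp y z - gp (i y') (i z')\<bar> \<le> e / 2"
    "\<bar>gp x z - gp (i x') (i z')\<bar> \<le> e / 2"
    using gp_approx[of x y "i x'" "i y'"] gp_approx[of y z "i y'" "i z'"]
      gp_approx[of x z "i x'" "i z'"] assms x' y' z' by auto
  then show "min (gp x y) (gp y z) \<le> gp x z + e"
    using gp_ultrametric_T[OF x'(1) y'(1) z'(1)] by linarith
qed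

text \<open>Replace \<open>x\<close> by a point \<open>z\<close> of \<open>T\<close> closer to it
  than \<open>nm x - t\<close>. Then \<open>gp x (i z)\<close> exceeds \<open>t\<close>, so the
  point at time \<open>t\<close> on the geodesic to \<open>z\<close>, which lies in
  \<open>T\<close>, already serves for \<open>x\<close>.\<close>

lemma point_exists:
  assumes "x \<in> M" "0 \<le> t" "t < nm x"
  obtains y where "y \<in> mspace T" "nm (i y) = t" "d (i y) x = nm x - t"
proof -
  obtain z where z: "z \<in> mspace T" "d x (i z) < nm x - t"
    using dense[of x "nm x - t"] assms by auto
  obtain g where g: "isometric_on {0..mdist T b z} T g" "g 0 = b" "g (mdist T b z) = z"
    using real_tree_geodesic[OF tree base z(1)] .
  have "t < gp x (i z)"
    using gp_ge[of x "i z"] assms z by simp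
  moreover have "gp x (i z) \<le> nm (i z)"
    using gp_le[of "i z" x] assms z by (simp add: gp_commute)
  ultimately have t: "t \<in> {0..mdist T b z}" "mdist T b z \<in> {0..mdist T b z}" "0 \<in> {0..mdist T b z}"
    using assms z base by auto
  then have "g t \<in> mspace T" "mdist T (g 0) (g t) = \<bar>0 - t\<bar>"
    "mdist T (g t) (g (mdist T b z)) = \<bar>t - mdist T b z\<bar>"
    using g(1) unfolding isometric_on_def by blast+
  then have y: "g t \<in> mspace T" "mdist T b (g t) = t" "mdist T (g t) z = mdist T b z - t"
    using t(1) g(2,3) by auto
  then have "gp (i (g t)) (i z) = t"
    unfolding gp_def using z base by simp
  then have "t \<le> gp (i (g t)) x"
    using gp_ultrametric[of "i (g t)" "i z" x] \<open>t < gp x (i z)\<close> assms z y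
    by (simp add: gp_commute)
  then have "d (i (g t)) x \<le> nm x - t"
    unfolding gp_def using y base by simp
  moreover have "nm x \<le> t + d (i (g t)) x"
    using B.triangle[of "i b" "i (g t)" x] assms y base by simp
  ultimately show ?thesis
    using that[of "g t"] y base by simp
qed

text \<open>Both points have Gromov product \<open>t\<close> with \<open>x\<close>, hence at least
  \<open>t\<close> with each other; at height \<open>t\<close> this leaves no room for a positive
  distance.\<close>

lemma point_unique:
  assumes "x \<in> M" "y \<in> M" "z \<in> M" "nm y = t" "nm z = t" "d y x = nm x - t" "d z x = nm x - t"
  shows "y = z"
proof -
  have "gp y x = t" "gp x z = t"
    unfolding gp_def using assms by (auto simp: B.commute)
  then have "t \<le> gp y z"
    using gp_ultrametric[of y x z] assms by simp
  then have "d y z = 0"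
    unfolding gp_def using assms B.nonneg[of y z] by simp
  then show ?thesis using assms by simp
qed

text \<open>The point at distance \<open>t\<close> from the base point on the geodesic from the base point to \<open>x\<close>.\<close>
definition seg :: "'b \<Rightarrow> real \<Rightarrow> 'b" where
  "seg x t = (SOME y. y \<in> M \<and> nm y = t \<and> d y x = nm x - t)"

lemma seg:
  assumes "x \<in> M" "0 \<le> t" "t \<le> nm x"
  shows "seg x t \<in> M" "nm (seg x t) = t" "d (seg x t) x = nm x - t"
proof -
  have "\<exists>y. y \<in> M \<and> nm y = t \<and> d y x = nm x - t"
  \<comment> \<open>The end point \<open>x\<close> need not come from \<open>T\<close>, so it is its
    own witness.\<close>
  proof (cases "t = nm x")
    case True
    then show ?thesis using assms by auto
  next
    case False
    then show ?thesis
      using point_exists[of x t] assms by (metis i_in order_le_imp_less_or_eq)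
  qed
  from someI_ex[OF this] show "seg x t \<in> M" "nm (seg x t) = t" "d (seg x t) x = nm x - t"
    unfolding seg_def by auto
qed

lemma seg_eqI:
  assumes "x \<in> M" "y \<in> M" "nm y = t" "d y x = nm x - t"
  shows "seg x t = y"
proof -
  have "0 \<le> t" "t \<le> nm x"
    using assms(3,4) B.nonneg[of "i b" y] B.nonneg[of y x] by auto
  then show ?thesis
    using point_unique[of x "seg x t" y t] seg[of x t] assms by auto
qed

lemma seg_nm [simp]: "x \<in> M \<Longrightarrow> seg x (nm x) = x"
  by (rule seg_eqI) auto

lemma seg_0: "x \<in> M \<Longrightarrow> seg x 0 = i b"
  by (rule seg_eqI) (auto simp: i_base_in)

text \<open>The completion adds only end points to segments. This is what later allows an unbounded
  union of segments to be pulled back to a ray in \<open>T\<close>.\<close>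

lemma seg_in_range:
  assumes "x \<in> M" "0 \<le> t" "t < nm x"
  shows "seg x t \<in> i ` mspace T"
  using point_exists[OF assms] seg_eqI[of x _ t] assms by (metis i_in imageI)

text \<open>The counterpart in the completion of \<open>real_tree_geodesics_agree_iff\<close>,
  obtained from the hyperbolicity inequality instead of unique arcs.\<close>

lemma seg_agree_iff:
  assumes "x \<in> M" "y \<in> M" "0 \<le> t" "t \<le> nm x" "t \<le> nm y"
  shows "seg x t = seg y t \<longleftrightarrow> t \<le> gp x y"
proof
  note x = seg[OF assms(1,3,4)] and y = seg[OF assms(2,3,5)]
  show "t \<le> gp x y" if "seg x t = seg y t"
    using B.triangle[of x "seg x t" y] that x y assms B.commute[of x "seg x t"]
    unfolding gp_def by simp
  show "seg x t = seg y t" if "t \<le> gp x y"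
  proof -
    have "gp (seg x t) x = t" unfolding gp_def using x by simp
    then have "t \<le> gp (seg x t) y"
      using gp_ultrametric[of "seg x t" x y] x assms that by simp
    then have "d (seg x t) y \<le> nm y - t"
      unfolding gp_def using x by simp
    moreover have "nm y \<le> t + d (seg x t) y"
      using B.triangle[of "i b" "seg x t" y] x assms i_base_in by simp
    ultimately show ?thesis
      using seg_eqI[of y "seg x t" t] x assms by simp
  qed
qed

text \<open>The points at times \<open>s \<le> t\<close> have Gromov products \<open>s\<close> and
  \<open>t\<close> with \<open>x\<close>, hence at least \<open>s\<close> with each other, which
  bounds their distance by \<open>t - s\<close>. Their heights give the reverse bound.\<close>

lemma isometric_on_seg:
  assumes "x \<in> M"
  shows "isometric_on {0..nm x} Tbar (seg x)"
proof -
  have le: "d (seg x s) (seg x t) = t - s" if "0 \<le> s" "s \<le> t" "t \<le> nm x" for s t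
  proof -
    note s = seg[of x s] and t = seg[of x t]
    have "gp (seg x s) x = s" "gp x (seg x t) = t"
      unfolding gp_def using that assms s t by (auto simp: B.commute)
    then have "s \<le> gp (seg x s) (seg x t)"
      using gp_ultrametric[of "seg x s" x "seg x t"] that assms s t by simp
    then have "d (seg x s) (seg x t) \<le> t - s"
      unfolding gp_def using that assms s t by simp
    moreover have "t \<le> s + d (seg x s) (seg x t)"
      using B.triangle[of "i b" "seg x s" "seg x t"] that assms s t i_base_in by simp
    ultimately show ?thesis by simp
  qed
  show ?thesis
    unfolding isometric_on_def
  proof (intro conjI ballI)
    show "seg x ` {0..nm x} \<subseteq> M" using seg assms by auto
    show "d (seg x s) (seg x t) = \<bar>s - t\<bar>" if "s \<in> {0..nm x}" "t \<in> {0..nm x}" for s t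
      using le[of s t] le[of t s] that by (cases "s \<le> t") (auto simp: B.commute)
  qed
qed

lemma seg_seg:
  assumes "x \<in> M" "0 \<le> s" "s \<le> t" "t \<le> nm x"
  shows "seg (seg x t) s = seg x s"
  using isometric_on_seg[OF assms(1)] seg[OF assms(1), of s] seg[OF assms(1), of t] assms
  unfolding isometric_on_def by (intro seg_eqI) auto

section \<open>Rays from the base point and the boundary\<close>

lemma raysD:
  assumes "\<rho> \<in> rays T" "0 \<le> s" "0 \<le> t"
  shows "\<rho> s \<in> mspace T" "mdist T (\<rho> s) (\<rho> t) = \<bar>s - t\<bar>"
  using assms unfolding rays_def isometric_on_def by auto

text \<open>After a while every ray moves straight away from \<open>b\<close>. The geodesic from
  \<open>b\<close> to such a late point, followed by the rest of the ray, is a ray from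
  \<open>b\<close> that differs from the given one only in compact initial pieces.\<close>

lemma ray_from_base:
  assumes \<rho>: "\<rho> \<in> rays T"
  obtains \<sigma> where "\<sigma> \<in> rays T" "\<sigma> 0 = b" "(\<rho>, \<sigma>) \<in> ray_equiv T"
proof -
  interpret A: Metric_space "mspace T" "mdist T" by (rule Metric_space_mspace_mdist)
  define f where "f t = i (\<rho> t)" for t
  have f: "f t \<in> M" if "0 \<le> t" for t
    using raysD[OF \<rho>] that unfolding f_def by simp
  have fd: "d (f s) (f t) = \<bar>s - t\<bar>" if "0 \<le> s" "0 \<le> t" for s t
    using raysD[OF \<rho>] that unfolding f_def by simp
  define N where "N = nm (f 0)"
  have far: "t - N \<le> nm (f t)" if "0 \<le> t" for t
    using B.triangle[of "f 0" "i b" "f t"] f[of t] f[of 0] fd[of 0 t] that i_base_in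
    by (simp add: N_def B.commute)
  \<comment> \<open>From \<open>t0\<close> on, the Gromov products of points of the ray with
    \<open>f t0\<close> are at least \<open>t0 - N = N + 1\<close>, while those with
    \<open>f 0\<close> are at most \<open>N\<close>.\<close>
  define t0 where "t0 = 2 * N + 1"
  have "0 \<le> t0" "0 \<le> N" unfolding t0_def N_def by auto
  define k where "k = nm (f t0)"
  have "0 \<le> k" unfolding k_def by simp
  have nm_f: "nm (f t) = k + (t - t0)" if "t0 \<le> t" for t
  proof -
    have "t0 - N \<le> gp (f t0) (f t)"
      using far[of t0] far[of t] fd[of t0 t] that \<open>0 \<le> t0\<close> unfolding gp_def by simp
    then have "N < gp (f t0) (f t)"
      using \<open>0 \<le> N\<close> unfolding t0_def by simp
    moreover have "gp (f 0) (f t) \<le> N" "gp (f 0) (f t0) \<le> N"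
      using gp_le[of "f 0"] f \<open>0 \<le> t0\<close> that unfolding N_def by auto
    \<comment> \<open>Of three Gromov products the two smaller ones coincide, and the one between
      \<open>f t0\<close> and \<open>f t\<close> is strictly larger than both others. Expanding the
      equality shows that \<open>nm (f t)\<close> grows at unit speed.\<close>
    ultimately have "gp (f 0) (f t0) = gp (f 0) (f t)"
      using gp_ultrametric[of "f 0" "f t" "f t0"] gp_ultrametric[of "f 0" "f t0" "f t"]
        f[of 0] f[of t] f[of t0] \<open>0 \<le> t0\<close> that by (simp add: gp_commute)
    then show ?thesis
      using fd[of 0 t] fd[of 0 t0] \<open>0 \<le> t0\<close> that unfolding gp_def k_def by simp
  qed
  have k: "k = mdist T b (\<rho> t0)"
    unfolding k_def f_def using raysD[OF \<rho>] \<open>0 \<le> t0\<close> base by simp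
  have "\<rho> t0 \<in> mspace T" using raysD[OF \<rho>] \<open>0 \<le> t0\<close> by simp
  then obtain g where g: "isometric_on {0..k} T g" "g 0 = b" "g k = \<rho> t0"
    using real_tree_geodesic[OF tree base] unfolding k by blast
  define \<sigma> where "\<sigma> s = (if s \<le> k then g s else \<rho> (t0 + (s - k)))" for s
  have \<sigma>_in: "\<sigma> s \<in> mspace T" if "0 \<le> s" for s
    using g(1) raysD[OF \<rho>] that \<open>0 \<le> t0\<close> unfolding \<sigma>_def isometric_on_def by auto
  have nm_\<sigma>: "mdist T b (\<sigma> s) = s" if "0 \<le> s" for s
  proof (cases "s \<le> k")
    case True
    then show ?thesis
      using g(1) that \<open>0 \<le> k\<close> unfolding \<sigma>_def isometric_on_def g(2)[symmetric] by simp
  next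
    case False
    then show ?thesis
      using nm_f[of "t0 + (s - k)"] raysD[OF \<rho>, of "t0 + (s - k)"] \<open>0 \<le> t0\<close> base
      unfolding \<sigma>_def f_def by simp
  qed
  have \<sigma>_le: "mdist T (\<sigma> s) (\<sigma> t) \<le> t - s" if "0 \<le> s" "s \<le> t" for s t
  proof -
    have 1: "mdist T (\<sigma> s) (\<sigma> t) \<le> t - s" if "0 \<le> s" "s \<le> t" "t \<le> k" for s t
      using g(1) that unfolding isometric_on_def \<sigma>_def by auto
    have 2: "mdist T (\<sigma> s) (\<sigma> t) \<le> t - s" if "k \<le> s" "s \<le> t" for s t
    proof -
      have "\<sigma> u = \<rho> (t0 + (u - k))" if "k \<le> u" for u
        using that g(3) unfolding \<sigma>_def by auto
      then show ?thesis
        using that raysD[OF \<rho>, of "t0 + (s - k)" "t0 + (t - k)"] \<open>0 \<le> t0\<close> by simp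
    qed
    consider "t \<le> k" | "k \<le> s" | "s \<le> k" "k \<le> t" by linarith
    then show ?thesis
    proof cases
      case 3
      then show ?thesis
        using 1[of s k] 2[of k t] A.triangle[of "\<sigma> s" "\<sigma> k" "\<sigma> t"] \<sigma>_in that \<open>0 \<le> k\<close> by auto
    qed (use 1 2 that in auto)
  qed
  \<comment> \<open>The upper bound is attained because the distance from \<open>b\<close> increases
    by \<open>t - s\<close> between the two points.\<close>
  have \<sigma>_eq: "mdist T (\<sigma> s) (\<sigma> t) = t - s" if "0 \<le> s" "s \<le> t" for s t
    using \<sigma>_le[OF that] A.triangle[of b "\<sigma> s" "\<sigma> t"] nm_\<sigma> \<sigma>_in base that by auto
  have ray: "\<sigma> \<in> rays T"
    unfolding rays_def isometric_on_def
  proof (intro CollectI conjI ballI)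
    show "mdist T (\<sigma> s) (\<sigma> t) = \<bar>s - t\<bar>" if "s \<in> {0..}" "t \<in> {0..}" for s t
      using \<sigma>_eq[of s t] \<sigma>_eq[of t s] that by (cases "s \<le> t") (auto simp: A.commute)
  qed (use \<sigma>_in in auto)
  have "compactin (mtopology_of T) (\<rho> ` {0..t0} \<union> \<sigma> ` {0..k})"
    using \<rho> ray unfolding rays_def
    by (intro compactin_Un isometric_on_compactin[of "{0..}"]) auto
  moreover have "\<rho> ` {0..} - \<sigma> ` {0..} \<subseteq> \<rho> ` {0..t0}"
  proof
    fix x assume "x \<in> \<rho> ` {0..} - \<sigma> ` {0..}"
    then obtain t where t: "0 \<le> t" "x = \<rho> t" "x \<notin> \<sigma> ` {0..}" by auto
    have "t \<le> t0"
    proof (rule ccontr)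
      assume "\<not> t \<le> t0"
      then have "x = \<sigma> (t - t0 + k)" using t unfolding \<sigma>_def by simp
      then show False using t \<open>\<not> t \<le> t0\<close> \<open>0 \<le> k\<close> by auto
    qed
    then show "x \<in> \<rho> ` {0..t0}" using t by simp
  qed
  moreover have "\<sigma> ` {0..} - \<rho> ` {0..} \<subseteq> \<sigma> ` {0..k}"
  proof
    fix x assume "x \<in> \<sigma> ` {0..} - \<rho> ` {0..}"
    then obtain t where t: "0 \<le> t" "x = \<sigma> t" "x \<notin> \<rho> ` {0..}" by auto
    have "t \<le> k"
    proof (rule ccontr)
      assume "\<not> t \<le> k"
      then have "x = \<rho> (t0 + (t - k))" using t unfolding \<sigma>_def by simp
      then show False using t \<open>\<not> t \<le> k\<close> \<open>0 \<le> t0\<close> by auto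
    qed
    then show "x \<in> \<sigma> ` {0..k}" using t by simp
  qed
  ultimately have "(\<rho>, \<sigma>) \<in> ray_equiv T"
    unfolding ray_equiv_def using \<rho> ray by blast
  moreover have "\<sigma> 0 = b" unfolding \<sigma>_def using g(2) \<open>0 \<le> k\<close> by simp
  ultimately show ?thesis using that ray by blast
qed

lemma compactin_bounded:
  assumes "compactin (mtopology_of T) K"
  obtains r where "\<And>x. x \<in> K \<Longrightarrow> mdist T b x \<le> r"
proof -
  interpret A: Metric_space "mspace T" "mdist T" by (rule Metric_space_mspace_mdist)
  have "A.mbounded K"
    using assms A.compactin_imp_mbounded unfolding mtopology_of_def by blast
  then obtain c r where K: "K \<subseteq> A.mcball c r"
    unfolding A.mbounded_def by blast
  have "mdist T b x \<le> mdist T b c + r" if "x \<in> K" for x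
    using K that A.triangle[of b c x] base by fastforce
  then show ?thesis using that by blast
qed

text \<open>Compact sets are bounded, so the difference of two equivalent images stays within a
  bounded distance of \<open>b\<close>.\<close>

lemma ray_equiv_far:
  assumes "(\<rho>, \<sigma>) \<in> ray_equiv T"
  obtains r where "\<And>x. r < mdist T b x \<Longrightarrow> x \<in> \<rho> ` {0..} \<longleftrightarrow> x \<in> \<sigma> ` {0..}"
proof -
  obtain K where K: "compactin (mtopology_of T) K"
    "(\<rho> ` {0..} - \<sigma> ` {0..}) \<union> (\<sigma> ` {0..} - \<rho> ` {0..}) \<subseteq> K"
    using assms unfolding ray_equiv_def by auto
  obtain r where "\<And>x. x \<in> K \<Longrightarrow> mdist T b x \<le> r"
    using compactin_bounded[OF K(1)] by blast
  then show ?thesis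
    using that[of r] K(2) by (meson Diff_iff UnCI in_mono linorder_not_less)
qed

text \<open>Far from \<open>b\<close> the images coincide, and a common point is reached at equal
  times because time is the distance from \<open>b\<close>. Uniqueness of geodesics then applies to
  all earlier times.\<close>

lemma base_ray_unique:
  assumes "(\<rho>, \<sigma>) \<in> ray_equiv T" "\<rho> 0 = b" "\<sigma> 0 = b" "0 \<le> t"
  shows "\<rho> t = \<sigma> t"
proof -
  have rays: "\<rho> \<in> rays T" "\<sigma> \<in> rays T"
    using assms unfolding ray_equiv_def by auto
  obtain r where r: "\<And>x. r < mdist T b x \<Longrightarrow> x \<in> \<rho> ` {0..} \<longleftrightarrow> x \<in> \<sigma> ` {0..}"
    using ray_equiv_far[OF assms(1)] by blast
  define u where "u = max t (r + 1)"
  have u: "t \<le> u" "r < u" "0 \<le> u" using assms(4) unfolding u_def by auto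
  have "mdist T b (\<rho> u) = u"
    using raysD[OF rays(1), of 0 u] u assms(2) by simp
  then obtain v where v: "0 \<le> v" "\<rho> u = \<sigma> v"
    using r[of "\<rho> u"] u by auto
  then have "u = v"
    using raysD[OF rays(2), of 0 v] \<open>mdist T b (\<rho> u) = u\<close> assms(3) by simp
  show ?thesis
  proof (rule real_tree_geodesic_unique[OF tree])
    show "isometric_on {0..u} T \<rho>" "isometric_on {0..u} T \<sigma>"
      using rays unfolding rays_def by (auto intro: isometric_on_subset)
  qed (use v \<open>u = v\<close> u assms in auto)
qed

text \<open>The ray from the base point that represents \<open>\<xi>\<close>; unique on \<open>{0..}\<close>, arbitrary elsewhere.\<close>
definition rep :: "(real \<Rightarrow> 'a) set \<Rightarrow> real \<Rightarrow> 'a" where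
  "rep \<xi> = (SOME \<rho>. \<rho> \<in> \<xi> \<and> \<rho> 0 = b)"

lemma rep:
  assumes "\<xi> \<in> gromov_boundary T"
  shows "rep \<xi> \<in> rays T" "rep \<xi> 0 = b" "rep \<xi> \<in> \<xi>" "\<xi> = ray_equiv T `` {rep \<xi>}"
proof -
  obtain \<rho> where \<rho>: "\<rho> \<in> rays T" "\<xi> = ray_equiv T `` {\<rho>}"
    using assms unfolding gromov_boundary_def by (auto elim: quotientE)
  obtain \<sigma> where "\<sigma> 0 = b" "(\<rho>, \<sigma>) \<in> ray_equiv T"
    using ray_from_base[OF \<rho>(1)] by blast
  then have "\<exists>\<rho>. \<rho> \<in> \<xi> \<and> \<rho> 0 = b"
    using \<rho> by blast
  from someI_ex[OF this] show *: "rep \<xi> \<in> \<xi>" "rep \<xi> 0 = b"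
    unfolding rep_def by auto
  then have "(\<rho>, rep \<xi>) \<in> ray_equiv T"
    using \<rho>(2) by simp
  then show "rep \<xi> \<in> rays T"
    by (simp add: ray_equiv_def)
  show "\<xi> = ray_equiv T `` {rep \<xi>}"
    using equiv_class_eq[OF equiv_ray_equiv \<open>(\<rho>, rep \<xi>) \<in> ray_equiv T\<close>] \<rho>(2) by argo
qed

lemma rep_eqI:
  assumes "\<xi> \<in> gromov_boundary T" "\<eta> \<in> gromov_boundary T" "\<And>t. 0 \<le> t \<Longrightarrow> rep \<xi> t = rep \<eta> t"
  shows "\<xi> = \<eta>"
proof -
  have "rep \<xi> ` {0..} = rep \<eta> ` {0..}"
    using assms(3) by auto
  then have "(rep \<xi>, rep \<eta>) \<in> ray_equiv T"
    using rep assms unfolding ray_equiv_def by (auto intro: exI[of _ "{}"])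
  then show ?thesis
    using rep(4) assms equiv_class_eq[OF equiv_ray_equiv] by metis
qed

lemma class_rep:
  assumes "\<xi> \<in> gromov_boundary T" "\<rho> \<in> \<xi>"
  shows "(rep \<xi>, \<rho>) \<in> ray_equiv T"
  using rep(4)[OF assms(1)] assms(2) by blast

lemma base_ray_class:
  assumes "\<sigma> \<in> rays T" "\<sigma> 0 = b"
  obtains \<xi> where "\<xi> \<in> gromov_boundary T" "\<And>t. 0 \<le> t \<Longrightarrow> rep \<xi> t = \<sigma> t"
proof -
  define \<xi> where "\<xi> = ray_equiv T `` {\<sigma>}"
  have \<xi>: "\<xi> \<in> gromov_boundary T" "\<sigma> \<in> \<xi>"
    unfolding \<xi>_def gromov_boundary_def
    using assms(1) equiv_class_self[OF equiv_ray_equiv] by (auto intro: quotientI)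
  then show ?thesis
    using that base_ray_unique[OF class_rep[OF \<xi>] rep(2)[OF \<xi>(1)] assms(2)] by blast
qed

end


section \<open>Geodesics from the base point and directions\<close>

context completed_tree
begin

abbreviation H :: "('b + (real \<Rightarrow> 'a) set) set" where "H \<equiv> hat T Tbar"

lemma Inl_in_hat [simp]: "Inl x \<in> H \<longleftrightarrow> x \<in> M"
  unfolding hat_def by auto

lemma Inr_in_hat [simp]: "Inr \<xi> \<in> H \<longleftrightarrow> \<xi> \<in> gromov_boundary T"
  unfolding hat_def by auto

text \<open>
  Every point \<open>R\<close> of \<open>hat T Tbar\<close> is encoded by the geodesic from the base point to it:
  \<open>extent R\<close> is the domain of this geodesic and \<open>gm R\<close> is its parametrization by arc length.
\<close>
definition extent :: "'b + (real \<Rightarrow> 'a) set \<Rightarrow> real set" where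
  "extent R = (case R of Inl x \<Rightarrow> {0..nm x} | Inr \<xi> \<Rightarrow> {0..})"

definition gm :: "'b + (real \<Rightarrow> 'a) set \<Rightarrow> real \<Rightarrow> 'b" where
  "gm R = (case R of Inl x \<Rightarrow> seg x | Inr \<xi> \<Rightarrow> i \<circ> rep \<xi>)"

lemma extent_simps [simp]: "extent (Inl x) = {0..nm x}" "extent (Inr \<xi>) = {0..}"
  unfolding extent_def by auto

lemma gm_simps [simp]: "gm (Inl x) = seg x" "gm (Inr \<xi>) = i \<circ> rep \<xi>"
  unfolding gm_def by auto

lemma extent_nonneg: "t \<in> extent R \<Longrightarrow> 0 \<le> t"
  by (cases R) auto

lemma zero_in_extent [simp]: "0 \<in> extent R"
  by (cases R) auto

lemma extent_downward: "t \<in> extent R \<Longrightarrow> 0 \<le> s \<Longrightarrow> s \<le> t \<Longrightarrow> s \<in> extent R"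
  by (cases R) auto

lemma is_interval_extent: "is_interval (extent R)"
  by (cases R) auto

lemma isometric_on_gm:
  assumes "R \<in> H"
  shows "isometric_on (extent R) Tbar (gm R)"
proof (cases R)
  case (Inl x)
  then show ?thesis using assms isometric_on_seg by simp
next
  case (Inr \<xi>)
  then show ?thesis
    using assms rep(1)[of \<xi>] isometric_on_i unfolding rays_def by simp
qed

lemma gm_in: "R \<in> H \<Longrightarrow> t \<in> extent R \<Longrightarrow> gm R t \<in> M"
  using isometric_on_gm unfolding isometric_on_def by blast

lemma gm_dist: "R \<in> H \<Longrightarrow> s \<in> extent R \<Longrightarrow> t \<in> extent R \<Longrightarrow> d (gm R s) (gm R t) = \<bar>s - t\<bar>"
  using isometric_on_gm unfolding isometric_on_def by blast

lemma gm_0: "R \<in> H \<Longrightarrow> gm R 0 = i b"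
  by (cases R) (auto simp: seg_0 rep)

lemma nm_gm: "R \<in> H \<Longrightarrow> t \<in> extent R \<Longrightarrow> nm (gm R t) = t"
  using gm_dist[of R 0 t] gm_0[of R] extent_nonneg[of t R] by simp

lemma seg_gm:
  assumes "R \<in> H" "t \<in> extent R" "0 \<le> s" "s \<le> t"
  shows "seg (gm R t) s = gm R s"
  using assms extent_downward[OF assms(2-4)] gm_dist[of R s t]
  by (intro seg_eqI) (auto simp: gm_in nm_gm)

lemma gm_in_range:
  assumes "R \<in> H" "t \<in> extent R" "s \<in> extent R" "s < t"
  shows "gm R s \<in> i ` mspace T"
  using seg_in_range[of "gm R t" s] assms extent_nonneg[of s R]
  by (simp add: gm_in nm_gm seg_gm)

section \<open>The tree order rooted at the base point\<close>

definition agree where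
  "agree R S t \<longleftrightarrow> t \<in> extent R \<and> t \<in> extent S \<and> gm R t = gm S t"

text \<open>The tree order: \<open>R\<close> lies on the geodesic from the base point to
  \<open>S\<close>. Comparing geodesics time by time, instead of through Gromov products, treats
  boundary points and points of the completion alike.\<close>

definition below where
  "below R S \<longleftrightarrow> (\<forall>t\<in>extent R. agree R S t)"

lemma agree_sym: "agree R S t \<Longrightarrow> agree S R t"
  unfolding agree_def by auto

lemma agree_trans: "agree R S t \<Longrightarrow> agree S Q t \<Longrightarrow> agree R Q t"
  unfolding agree_def by auto

lemma agree_0: "R \<in> H \<Longrightarrow> S \<in> H \<Longrightarrow> agree R S 0"
  unfolding agree_def by (simp add: gm_0)

lemma agree_downward:
  assumes "R \<in> H" "S \<in> H" "agree R S t" "0 \<le> s" "s \<le> t"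
  shows "agree R S s"
  using assms seg_gm[of R t s] seg_gm[of S t s] extent_downward
  unfolding agree_def by auto

lemma below_refl: "below R R"
  unfolding below_def agree_def by simp

lemma below_trans: "below P Q \<Longrightarrow> below Q R \<Longrightarrow> below P R"
  unfolding below_def using agree_trans by (metis agree_def)

lemma below_antisym:
  assumes "R \<in> H" "S \<in> H" "below R S" "below S R"
  shows "R = S"
proof -
  have ext: "extent R = extent S"
    using assms(3,4) unfolding below_def agree_def by blast
  have gm: "gm R t = gm S t" if "t \<in> extent R" for t
    using assms(3) that unfolding below_def agree_def by blast
  \<comment> \<open>A bounded extent belongs to a point of the completion and an unbounded one to a
    boundary point, so \<open>R\<close> and \<open>S\<close> are of the same kind.\<close>
  have no: "{0..x} \<noteq> {0..}" for x :: real
  proof -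
    have "max x 0 + 1 \<in> {0..}" "max x 0 + 1 \<notin> {0..x}" by auto
    then show ?thesis by metis
  qed
  show ?thesis
  proof (cases R)
    case (Inl x)
    then obtain y where y: "S = Inl y"
      using ext no by (cases S) auto
    then have "nm x = nm y"
      using ext Inl by simp
    then show ?thesis
      using gm[of "nm x"] seg_nm[of x] seg_nm[of y] Inl y assms by simp
  next
    case (Inr \<xi>)
    then obtain \<eta> where \<eta>: "S = Inr \<eta>"
      using ext no by (cases S) (auto dest: sym)
    have "rep \<xi> t = rep \<eta> t" if "0 \<le> t" for t
      using gm[of t] that Inr \<eta> assms i_inj raysD(1) rep(1) by simp
    then show ?thesis
      using rep_eqI[of \<xi> \<eta>] Inr \<eta> assms by simp
  qed
qed

lemma extent_total: "extent R \<subseteq> extent S \<or> extent S \<subseteq> extent R"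
  by (meson extent_downward extent_nonneg linear subsetI)

lemma notin_extent_greater: "u \<notin> extent R \<Longrightarrow> 0 \<le> u \<Longrightarrow> t \<in> extent R \<Longrightarrow> t < u"
  using extent_downward not_le by blast

lemma below_total:
  assumes "below P R" "below Q R"
  shows "below P Q \<or> below Q P"
  using extent_total[of P Q] assms unfolding below_def agree_def by auto

text \<open>Cutting the geodesic of \<open>R\<close> at time \<open>t\<close> yields a point of the
  completion below \<open>R\<close>, even when \<open>R\<close> is a boundary point.\<close>

lemma truncate:
  assumes "R \<in> H" "t \<in> extent R"
  shows "Inl (gm R t) \<in> H" "extent (Inl (gm R t)) = {0..t}"
    "\<And>s. 0 \<le> s \<Longrightarrow> s \<le> t \<Longrightarrow> agree (Inl (gm R t)) R s"
  using assms extent_downward unfolding agree_def by (auto simp: gm_in nm_gm seg_gm)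

text \<open>The geodesics to the members of a chain fit together. An unbounded union is a ray and
  defines a boundary point; a bounded one converges to an end point by completeness. The last
  conclusion expresses that the supremum is least: members of the chain extend past every time
  before its end.\<close>

lemma chain_supremum:
  assumes "A \<subseteq> H" "A \<noteq> {}" and chain: "\<And>P Q. P \<in> A \<Longrightarrow> Q \<in> A \<Longrightarrow> below P Q \<or> below Q P"
  obtains R where "R \<in> H" "\<And>P. P \<in> A \<Longrightarrow> below P R"
    "\<And>u t. u \<in> extent R \<Longrightarrow> t < u \<Longrightarrow> \<exists>P\<in>A. \<exists>v\<in>extent P. t < v"
proof -
  define E where "E = (\<Union>P\<in>A. extent P)"
  \<comment> \<open>The choice does not matter: any two members of the chain agree at a time common
    to both.\<close>
  define g where "g t = gm (SOME P. P \<in> A \<and> t \<in> extent P) t" for t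
  have g: "g t = gm P t" if "P \<in> A" "t \<in> extent P" for P t
  proof -
    have "\<exists>P. P \<in> A \<and> t \<in> extent P" using that by blast
    from someI_ex[OF this] obtain Q where "Q \<in> A" "t \<in> extent Q" "g t = gm Q t"
      unfolding g_def by blast
    then have "agree P Q t \<or> agree Q P t"
      using chain[OF that(1) \<open>Q \<in> A\<close>] that(2) unfolding below_def by blast
    then show ?thesis
      using \<open>g t = gm Q t\<close> unfolding agree_def by auto
  qed
  have E_down: "s \<in> E" if "t \<in> E" "0 \<le> s" "s \<le> t" for s t
    using that extent_downward unfolding E_def by blast
  have "0 \<in> E" using assms(2) unfolding E_def by auto
  have E_nonneg: "0 \<le> t" if "t \<in> E" for t
    using that extent_nonneg unfolding E_def by auto
  have g_in: "g t \<in> M" if "t \<in> E" for t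
    using that g gm_in assms(1) unfolding E_def by auto
  have nm_g: "nm (g t) = t" if "t \<in> E" for t
    using that g nm_gm assms(1) unfolding E_def by auto
  have g_dist: "d (g s) (g t) = \<bar>s - t\<bar>" if st: "s \<in> E" "t \<in> E" for s t
  proof -
    have *: "d (g s) (g t) = \<bar>s - t\<bar>" if le: "s \<in> E" "t \<in> E" "s \<le> t" for s t
    proof -
      obtain P where P: "P \<in> A" "t \<in> extent P" using le(2) unfolding E_def by auto
      then have "s \<in> extent P" using extent_downward E_nonneg le by blast
      then show ?thesis using P g gm_dist[of P s t] assms(1) by auto
    qed
    show ?thesis
      using *[of s t] *[of t s] st by (cases "s \<le> t") (auto simp: B.commute)
  qed
  have below: "below P R" if "P \<in> A" "\<And>t. t \<in> E \<Longrightarrow> t \<in> extent R \<and> gm R t = g t" for P R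
    unfolding below_def agree_def
  proof (intro ballI conjI)
    fix t assume t: "t \<in> extent P"
    then have "t \<in> E" using that(1) unfolding E_def by blast
    then show "t \<in> extent R" "gm P t = gm R t"
      using that(2)[of t] g[OF that(1) t] by auto
  qed
  show ?thesis
  proof (cases "bdd_above E")
    case False
    then have E: "t \<in> E" if "0 \<le> t" for t
      using E_down that unfolding bdd_above_def by (meson linear)
    \<comment> \<open>No time is the last one, so each \<open>g t\<close> is an interior point of a
      longer geodesic and therefore comes from \<open>T\<close>.\<close>
    have g_range: "g t \<in> i ` mspace T" if t: "0 \<le> t" for t
    proof -
      obtain P where P: "P \<in> A" "t + 1 \<in> extent P"
        using E[of "t + 1"] t unfolding E_def by auto
      then have "t \<in> extent P" using extent_downward t by simp
      then show ?thesis
        using gm_in_range[OF _ P(2)] g[OF P(1)] P(1) assms(1) by auto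
    qed
    define \<sigma> where "\<sigma> t = inv_into (mspace T) i (g t)" for t
    have \<sigma>: "\<sigma> t \<in> mspace T" "i (\<sigma> t) = g t" if "0 \<le> t" for t
      using g_range[OF that] unfolding \<sigma>_def by (auto intro: inv_into_into f_inv_into_f)
    have "\<sigma> \<in> rays T"
      using \<sigma> g_dist E i_dist unfolding rays_def isometric_on_def
      by (auto simp: image_subset_iff simp flip: i_dist)
    moreover have "\<sigma> 0 = b"
      using \<sigma>[of 0] nm_g[of 0] \<open>0 \<in> E\<close> g_in[of 0] i_base_in base
      by (metis B.zero i_inj order_refl)
    ultimately obtain \<xi> where \<xi>: "\<xi> \<in> gromov_boundary T" "\<And>t. 0 \<le> t \<Longrightarrow> rep \<xi> t = \<sigma> t"
      using base_ray_class by metis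
    show ?thesis
    proof (rule that[of "Inr \<xi>"])
      show "below P (Inr \<xi>)" if "P \<in> A" for P
        using below[OF that] \<xi> \<sigma> E_nonneg by simp
      show "\<exists>P\<in>A. \<exists>v\<in>extent P. t < v" if "u \<in> extent (Inr \<xi>)" "t < u" for u t
        using E[of u] that unfolding E_def by auto
    qed (use \<xi> in simp)
  next
    case True
    define L where "L = Sup E"
    have L: "t \<le> L" if "t \<in> E" for t
      unfolding L_def using that True by (rule cSup_upper)
    have "0 \<le> L" using L \<open>0 \<in> E\<close> by simp
    have L_less: "\<exists>v\<in>E. t < v" if "t < L" for t
      using less_cSupE[of t E] that \<open>0 \<in> E\<close> unfolding L_def by blast
    \<comment> \<open>The supremum \<open>L\<close> may fail to be in \<open>E\<close>, so it is
      approached from below. The sequence starts at \<open>0\<close>, and is constantly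
      \<open>0\<close> when \<open>L = 0\<close>.\<close>
    define u where "u n = L - L / real (Suc n)" for n
    have u: "u n \<in> E" for n
    proof (cases "L = 0")
      case True
      then show ?thesis using \<open>0 \<in> E\<close> unfolding u_def by simp
    next
      case False
      then have "u n < L" "0 \<le> u n"
        using \<open>0 \<le> L\<close> unfolding u_def by (auto simp: field_simps)
      then show ?thesis using L_less[of "u n"] E_down by fastforce
    qed
    have u_lim: "u \<longlonglongrightarrow> L"
    proof -
      have "(\<lambda>n. L - L * inverse (real (Suc n))) \<longlonglongrightarrow> L - L * 0"
        by (intro tendsto_intros LIMSEQ_inverse_real_of_nat)
      then show ?thesis unfolding u_def by (simp add: divide_inverse)
    qed
    have "B.MCauchy (g \<circ> u)"
      unfolding B.MCauchy_def
    proof (intro conjI allI impI)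
      show "range (g \<circ> u) \<subseteq> M" using g_in u by auto
      fix e :: real assume "0 < e"
      then obtain N where "\<forall>m\<ge>N. \<forall>n\<ge>N. dist (u m) (u n) < e"
        using LIMSEQ_imp_Cauchy[OF u_lim] unfolding Cauchy_def by blast
      then show "\<exists>N. \<forall>n n'. N \<le> n \<longrightarrow> N \<le> n' \<longrightarrow> d ((g \<circ> u) n) ((g \<circ> u) n') < e"
        using g_dist u by (auto simp: dist_real_def)
    qed
    moreover have "B.mcomplete"
      using compl unfolding metric_completion_of_def mcomplete_of_def by blast
    ultimately obtain x where x: "limitin B.mtopology (g \<circ> u) x sequentially"
      unfolding B.mcomplete_def by blast
    have "x \<in> M" using x B.limitin_mspace by blast
    have to_0: "(\<lambda>n. d (g (u n)) x) \<longlonglongrightarrow> 0"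
      using x unfolding B.limitin_metric_dist_null by (simp add: comp_def)
    \<comment> \<open>The distances from \<open>g t\<close> to \<open>g (u n)\<close> are known, and
      they tend both to \<open>L - t\<close> and to the distance to the limit
      \<open>x\<close>.\<close>
    have gx: "d (g t) x = L - t" if "t \<in> E" for t
    proof (rule LIMSEQ_unique)
      have "(\<lambda>n. \<bar>t - u n\<bar>) \<longlonglongrightarrow> \<bar>t - L\<bar>"
        using u_lim by (intro tendsto_intros)
      then show "(\<lambda>n. \<bar>t - u n\<bar>) \<longlonglongrightarrow> L - t"
        using L[OF that] by simp
      have "\<bar>d (g t) x - \<bar>t - u n\<bar>\<bar> \<le> d (g (u n)) x" for n
        using g_dist[OF that u[of n]] B.triangle[of "g t" "g (u n)" x]
          B.triangle[of "g t" x "g (u n)"] g_in[OF that] g_in[OF u[of n]] \<open>x \<in> M\<close>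
        by (simp add: B.commute)
      then have "(\<lambda>n. \<bar>t - u n\<bar> - d (g t) x) \<longlonglongrightarrow> 0"
        by (intro Lim_null_comparison[OF _ to_0]) (auto simp: abs_minus_commute)
      then show "(\<lambda>n. \<bar>t - u n\<bar>) \<longlonglongrightarrow> d (g t) x"
        by (simp add: LIM_zero_iff)
    qed
    have "g 0 = i b"
      using nm_g[OF \<open>0 \<in> E\<close>] g_in[OF \<open>0 \<in> E\<close>] i_base_in by simp
    then have "nm x = L"
      using gx[OF \<open>0 \<in> E\<close>] by simp
    show ?thesis
    proof (rule that[of "Inl x"])
      show "below P (Inl x)" if "P \<in> A" for P
        using below[OF that, of "Inl x"] L E_nonneg \<open>nm x = L\<close> \<open>x \<in> M\<close> seg_eqI[of x] g_in nm_g gx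
        by simp
      show "\<exists>P\<in>A. \<exists>v\<in>extent P. t < v" if "u \<in> extent (Inl x)" "t < u" for u t
        using L_less[of t] that \<open>nm x = L\<close> unfolding E_def by auto
    qed (use \<open>x \<in> M\<close> in simp)
  qed
qed

text \<open>The condition \<open>u \<notin> extent P\<close> makes \<open>u\<close> a time past
  \<open>P\<close>. Some such time suffices, however close to \<open>P\<close>, since points in one
  direction may branch right after \<open>P\<close>. A boundary point is below no other point, so
  its directions fall into the second case.\<close>

definition dirn where
  "dirn P Q = (if below P Q then {R \<in> H. \<exists>u. u \<notin> extent P \<and> agree R Q u} else {R \<in> H. \<not> below P R})"

lemma dirn_subset: "dirn P Q \<subseteq> H - {P}"
  unfolding dirn_def agree_def using below_refl by auto

lemma dirn_self:
  assumes "P \<in> H" "Q \<in> H" "P \<noteq> Q"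
  shows "Q \<in> dirn P Q"
proof (cases "below P Q")
  case True
  have "\<exists>u. u \<notin> extent P \<and> agree Q Q u"
  proof (rule ccontr)
    assume "\<not> ?thesis"
    then have "below Q P"
      using True unfolding below_def agree_def by metis
    then show False using below_antisym assms True by blast
  qed
  then show ?thesis using True assms unfolding dirn_def by simp
qed (use assms in \<open>auto simp: dirn_def\<close>)

lemma below_cylinder:
  assumes "P \<in> H" "Q \<in> H" "R \<in> H" "below P Q" "u \<notin> extent P" "agree R Q u"
  shows "below P R"
  unfolding below_def
proof
  fix t assume t: "t \<in> extent P"
  have "0 \<le> u" using assms(6) extent_nonneg unfolding agree_def by blast
  then have "t < u" using notin_extent_greater assms(5) t by blast
  then have "agree R Q t"
    using agree_downward[OF assms(3,2,6)] extent_nonneg[OF t] by simp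
  then show "agree P R t"
    using assms(4) t agree_trans agree_sym unfolding below_def by blast
qed

text \<open>Transitivity for agreements known at different times: the smaller time serves for both,
  and it is one of the two, so it also avoids \<open>X\<close>.\<close>

lemma agree_trans_min:
  assumes "R \<in> H" "S \<in> H" "Q \<in> H" "agree R S u" "agree S Q v" "u \<notin> X" "v \<notin> X"
  shows "\<exists>w. w \<notin> X \<and> agree R Q w"
proof -
  have "0 \<le> u" "0 \<le> v" using assms(4,5) extent_nonneg unfolding agree_def by blast+
  then have "agree R S (min u v)" "agree S Q (min u v)"
    using agree_downward[OF assms(1,2,4)] agree_downward[OF assms(2,3,5)] by auto
  then show ?thesis
    using agree_trans assms(6,7) by (metis min_def)
qed

lemma dirn_eq:
  assumes "P \<in> H" "Q \<in> H" "R \<in> dirn P Q"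
  shows "dirn P R = dirn P Q"
proof (cases "below P Q")
  case True
  then obtain u where u: "R \<in> H" "u \<notin> extent P" "agree R Q u"
    using assms unfolding dirn_def by auto
  then have "below P R" using below_cylinder assms True by blast
  then show ?thesis
    using True u assms agree_trans_min[of _ R Q _ u "extent P"]
      agree_trans_min[of _ Q R _ u "extent P"] agree_sym[OF u(3)]
    unfolding dirn_def by auto
qed (use assms in \<open>auto simp: dirn_def\<close>)

text \<open>Once the sets \<open>dirn P Q\<close> are known to be open, this makes each of them
  closed in the complement of \<open>P\<close> as well.\<close>

lemma dirn_union:
  assumes "P \<in> H" "Q \<in> H"
  shows "H - {P} - dirn P Q = \<Union> {dirn P R |R. R \<in> H - {P} - dirn P Q}"
proof
  show "H - {P} - dirn P Q \<subseteq> \<Union> {dirn P R |R. R \<in> H - {P} - dirn P Q}"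
    using dirn_self assms by blast
  show "\<Union> {dirn P R |R. R \<in> H - {P} - dirn P Q} \<subseteq> H - {P} - dirn P Q"
  proof
    fix S assume "S \<in> \<Union> {dirn P R |R. R \<in> H - {P} - dirn P Q}"
    then obtain R where R: "R \<in> H" "R \<noteq> P" "R \<notin> dirn P Q" "S \<in> dirn P R" by blast
    then have "S \<notin> dirn P Q"
      using dirn_eq[OF assms] dirn_eq[OF assms(1) R(1)] dirn_self[OF assms(1) R(1)] by metis
    then show "S \<in> H - {P} - dirn P Q" using R(4) dirn_subset by blast
  qed
qed

text \<open>By antisymmetry one of the two points, say \<open>Q\<close>, is not below the other.
  Cutting the geodesic of \<open>Q\<close> shortly after it leaves that of \<open>P\<close>, but
  before its end, gives a point that is below \<open>Q\<close> and not below
  \<open>P\<close>.\<close>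

lemma Hausdorff_separation:
  assumes "P \<in> H" "Q \<in> H" "P \<noteq> Q"
  obtains R where "R \<in> H" "P \<noteq> R" "Q \<noteq> R" "dirn R P \<inter> dirn R Q = {}"
proof -
  have *: "\<exists>R\<in>H. P \<noteq> R \<and> Q \<noteq> R \<and> dirn R P \<inter> dirn R Q = {}"
    if PQ: "P \<in> H" "Q \<in> H" and "\<not> below Q P" for P Q
  proof -
    obtain t where t: "t \<in> extent Q" "\<not> agree P Q t"
      using \<open>\<not> below Q P\<close> agree_sym unfolding below_def by blast
    then have "0 < t"
      using extent_nonneg[OF t(1)] agree_0[OF PQ] by (cases "t = 0") auto
    \<comment> \<open>A time strictly before \<open>t\<close> keeps the separating point different
      from \<open>Q\<close>. It exists because agreement at all times in the open interval from
      \<open>0\<close> to \<open>t\<close> would extend to \<open>t\<close>: extents contain their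
      bounds and the geodesics are continuous.\<close>
    have "\<exists>s. 0 < s \<and> s < t \<and> \<not> agree P Q s"
    proof (rule ccontr)
      assume "\<not> ?thesis"
      then have all: "agree P Q s" if "0 < s" "s < t" for s using that by blast
      have "t \<in> extent P"
      proof (cases P)
        case (Inl x)
        have "t \<le> nm x"
        proof (rule dense_le_bounded[OF \<open>0 < t\<close>])
          show "s \<le> nm x" if "0 < s" "s < t" for s
            using all[OF that] Inl unfolding agree_def by simp
        qed
        then show ?thesis using Inl \<open>0 < t\<close> by simp
      qed (use \<open>0 < t\<close> in simp)
      moreover have "d (gm P t) (gm Q t) \<le> 0"
      proof (rule field_le_epsilon)
        fix e :: real assume "0 < e"
        \<comment> \<open>Within \<open>e / 2\<close> of \<open>t\<close>, since both geodesics
          contribute \<open>t - s\<close>; the bound \<open>t / 2\<close> keeps \<open>s\<close>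
          positive.\<close>
        define s where "s = max (t / 2) (t - e / 2)"
        have s: "0 < s" "s < t" "t - s \<le> e / 2"
          using \<open>0 < e\<close> \<open>0 < t\<close> unfolding s_def by (auto simp: max_def)
        then have ag: "agree P Q s" using all by blast
        have "d (gm P t) (gm Q t) \<le> d (gm P t) (gm P s) + d (gm Q s) (gm Q t)"
          using B.triangle[of "gm P t" "gm P s" "gm Q t"] ag \<open>t \<in> extent P\<close> t PQ
          unfolding agree_def by (simp add: gm_in)
        also have "\<dots> = (t - s) + (t - s)"
          using ag \<open>t \<in> extent P\<close> t PQ s gm_dist[of P t s] gm_dist[of Q s t]
          unfolding agree_def by simp
        finally show "d (gm P t) (gm Q t) \<le> 0 + e" using s by simp
      qed
      ultimately have "gm P t = gm Q t"
        using gm_in[of P t] gm_in[of Q t] PQ t B.nonneg[of "gm P t" "gm Q t"] B.zero by force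
      then show False using t \<open>t \<in> extent P\<close> unfolding agree_def by simp
    qed
    then obtain s where s: "0 < s" "s < t" "\<not> agree P Q s" by blast
    have "s \<in> extent Q" using extent_downward t(1) s by simp
    define R :: "'b + (real \<Rightarrow> 'a) set" where "R = Inl (gm Q s)"
    note R = truncate[OF PQ(2) \<open>s \<in> extent Q\<close>, folded R_def]
    have "\<not> below R P"
    proof
      assume "below R P"
      then have "agree P R s" using R(2) s agree_sym unfolding below_def by simp
      moreover have "agree R Q s" using R(3)[of s] s by simp
      ultimately show False using s(3) agree_trans by blast
    qed
    moreover have "below R Q"
      using R(2,3) unfolding below_def by simp
    moreover have "Q \<noteq> R" using t s R(2) by auto
    moreover have "P \<noteq> R" using \<open>\<not> below R P\<close> below_refl by blast
    moreover have "dirn R P \<inter> dirn R Q = {}"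
      using dirn_eq[OF R(1) PQ(1)] dirn_eq[OF R(1) PQ(2)] dirn_self[OF R(1) PQ(1)]
        below_cylinder[OF R(1) PQ(2)] \<open>\<not> below R P\<close> \<open>below R Q\<close>
      unfolding dirn_def by auto
    ultimately show ?thesis using R(1) by blast
  qed
  have "\<not> below Q P \<or> \<not> below P Q"
    using below_antisym assms by blast
  then show ?thesis
    using *[of P Q] *[of Q P] assms that by (metis Int_commute)
qed

lemma finite_subcover_of_directions:
  assumes sub: "\<C> \<subseteq> {dirn P Q |P Q. P \<in> H \<and> Q \<in> H \<and> P \<noteq> Q}" and cover: "H \<subseteq> \<Union>\<C>"
  shows "\<exists>\<F>. finite \<F> \<and> \<F> \<subseteq> \<C> \<and> H \<subseteq> \<Union>\<F>"
proof -
  \<comment> \<open>For \<open>P\<close> other than the base point, the direction at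
    \<open>P\<close> that contains the base point.\<close>
  define up where "up P = {R \<in> H. \<not> below P R}" for P
  define A where "A = {P \<in> H. up P \<in> \<C>}"
  have dir_cases: "(\<exists>P\<in>A. V = up P) \<or>
      (\<exists>P\<in>H. \<exists>Q\<in>H. below P Q \<and> V = {R \<in> H. \<exists>u. u \<notin> extent P \<and> agree R Q u})" if "V \<in> \<C>" for V
    using sub that unfolding dirn_def A_def up_def by fastforce
  have "Inl (i b) \<in> H" using i_base_in by simp
  then obtain V where V: "V \<in> \<C>" "Inl (i b) \<in> V" using cover by blast
  \<comment> \<open>The geodesic of the base point has only time \<open>0\<close>, which is never
    past a point, so only a set \<open>up P\<close> can cover it.\<close>
  have "A \<noteq> {}"
    using dir_cases[OF V(1)] V(2) i_base_in by (auto simp: agree_def)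
  show ?thesis
  proof (cases "\<forall>P\<in>A. \<forall>Q\<in>A. below P Q \<or> below Q P")
    case False
    then obtain P Q where PQ: "P \<in> A" "Q \<in> A" "\<not> below P Q" "\<not> below Q P" by blast
    then have "R \<in> up P \<or> R \<in> up Q" if "R \<in> H" for R
      using below_total[of P R Q] that unfolding up_def by blast
    then have "H \<subseteq> \<Union>{up P, up Q}" by auto
    then show ?thesis
      using PQ unfolding A_def by (intro exI[of _ "{up P, up Q}"]) auto
  next
    case True
    obtain S where S: "S \<in> H" "\<And>P. P \<in> A \<Longrightarrow> below P S"
      "\<And>u t. u \<in> extent S \<Longrightarrow> t < u \<Longrightarrow> \<exists>P\<in>A. \<exists>v\<in>extent P. t < v"
      using chain_supremum[of A] True \<open>A \<noteq> {}\<close> unfolding A_def by blast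
    obtain V where V: "V \<in> \<C>" "S \<in> V" using cover S(1) by blast
    have "V \<noteq> up P" if "P \<in> A" for P
      using S(2)[OF that] V(2) unfolding up_def by blast
    then obtain P Q where PQ: "P \<in> H" "Q \<in> H" "below P Q"
      "V = {R \<in> H. \<exists>u. u \<notin> extent P \<and> agree R Q u}"
      using dir_cases[OF V(1)] by blast
    then obtain u where u: "u \<notin> extent P" "agree S Q u" using V(2) by blast
    have "0 \<le> u" "u \<in> extent S" using u extent_nonneg unfolding agree_def by blast+
    then obtain p where p: "P = Inl p" using u by (cases P) auto
    then have "nm p < u" using u \<open>0 \<le> u\<close> by auto
    \<comment> \<open>Leastness of \<open>S\<close> yields a member of the chain that reaches past
      \<open>P\<close>. Everything beyond this member agrees with \<open>S\<close>, hence with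
      \<open>Q\<close>, at a time past \<open>P\<close>, and so lies in \<open>V\<close>; everything
      else lies in \<open>up P'\<close>.\<close>
    then obtain P' v where P': "P' \<in> A" "v \<in> extent P'" "nm p < v"
      using S(3)[OF \<open>u \<in> extent S\<close>] by blast
    then have v: "v \<notin> extent P" using p by simp
    have "P' \<in> H" using P' unfolding A_def by simp
    have "H \<subseteq> \<Union>{up P', V}"
    proof
      fix R assume R: "R \<in> H"
      show "R \<in> \<Union>{up P', V}"
      proof (cases "below P' R")
        case True
        then have "agree R P' v" "agree P' S v"
          using S(2)[OF P'(1)] P'(2) agree_sym unfolding below_def by auto
        then have "\<exists>w. w \<notin> extent P \<and> agree R Q w"
          using agree_trans_min[OF R S(1) PQ(2) _ u(2) v u(1)] agree_trans by blast
        then show ?thesis using R PQ(4) by simp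
      qed (use R in \<open>simp add: up_def\<close>)
    qed
    then show ?thesis
      using P' V unfolding A_def by (intro exI[of _ "{up P', V}"]) auto
  qed
qed

end


section \<open>The metric and the observers' topology\<close>

lemma topspace_topology_with_subbasis [simp]: "topspace (topology_with_subbasis U \<B>) = U"
  unfolding topology_with_subbasis_def by simp

lemma openin_topology_with_subbasis:
  assumes "S \<in> \<B>" "S \<subseteq> U"
  shows "openin (topology_with_subbasis U \<B>) S"
proof -
  have "(finite intersection_of (\<lambda>S. S \<in> \<B>) relative_to U) S"
    unfolding relative_to_def using assms by (metis finite_intersection_of_inc inf.absorb2)
  then show ?thesis
    unfolding topology_with_subbasis_def openin_subbase by (rule arbitrary_union_of_inc)
qed

text \<open>The sets that contain the values eventually if they contain \<open>l\<close> form a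
  topology, so it is enough that they include the subbasis and the whole set.\<close>

lemma limitin_topology_with_subbasis:
  assumes "l \<in> U" "\<And>S. S \<in> \<B> \<Longrightarrow> l \<in> S \<Longrightarrow> eventually (\<lambda>x. f x \<in> S) F"
    "eventually (\<lambda>x. f x \<in> U) F"
  shows "limitin (topology_with_subbasis U \<B>) f l F"
proof -
  define P where "P V \<longleftrightarrow> (l \<in> V \<longrightarrow> eventually (\<lambda>x. f x \<in> V) F)" for V
  have "istopology P"
    unfolding istopology_def
  proof (intro conjI allI impI)
    show "P (V \<inter> W)" if "P V" "P W" for V W
      using that unfolding P_def by (auto intro: eventually_conj)
    show "P (\<Union>\<V>)" if "\<forall>V\<in>\<V>. P V" for \<V>
      using that unfolding P_def by (auto elim!: eventually_mono dest!: bspec)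
  qed
  then have P: "openin (topology P) = P" by (rule topology_inverse')
  have "P V" if "openin (topology_with_subbasis U \<B>) V" for V
    using minimal_topology_subbase[of "\<lambda>S. S \<in> \<B>" "topology P" U V] assms that
    unfolding topology_with_subbasis_def P by (auto simp: P_def)
  then show ?thesis
    unfolding limitin_def P_def using assms(1) by simp
qed

lemma connectedin_star:
  assumes "Q \<in> W" "\<And>R. R \<in> W \<Longrightarrow> \<exists>S. connectedin X S \<and> Q \<in> S \<and> R \<in> S \<and> S \<subseteq> W"
  shows "connectedin X W"
proof -
  define \<U> where "\<U> = {S. connectedin X S \<and> Q \<in> S \<and> S \<subseteq> W}"
  have "W = \<Union>\<U>"
  proof
    show "W \<subseteq> \<Union>\<U>"
    proof
      fix R assume "R \<in> W"
      from assms(2)[OF this] obtain S where "connectedin X S" "Q \<in> S" "R \<in> S" "S \<subseteq> W"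
        by blast
      then show "R \<in> \<Union>\<U>" unfolding \<U>_def by blast
    qed
  qed (auto simp: \<U>_def)
  moreover have "connectedin X (\<Union>\<U>)"
  proof (rule connectedin_Union)
    have "Q \<in> \<Inter>\<U>" unfolding \<U>_def by simp
    then show "\<Inter>\<U> \<noteq> {}" by (metis empty_iff)
  qed (simp add: \<U>_def)
  ultimately show ?thesis by simp
qed

section \<open>The metric topology on the completion and near the boundary\<close>

context completed_tree
begin

abbreviation mt :: "'b topology" where "mt \<equiv> mtopology_of Tbar"

abbreviation X :: "('b + (real \<Rightarrow> 'a) set) topology" where "X \<equiv> hat_metric_topology T Tbar i"

abbreviation comps :: "'a \<Rightarrow> 'b set set" where
  "comps p \<equiv> connected_components_of (subtopology mt (M - {i p}))"

lemma topspace_X [simp]: "topspace X = H"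
  unfolding hat_metric_topology_def by simp

lemma comps_subset: "C \<in> comps p \<Longrightarrow> C \<subseteq> M - {i p}"
  using connected_components_of_subset by fastforce

lemma comps_maximal:
  assumes "C \<in> comps p" "connectedin mt S" "S \<subseteq> M - {i p}" "S \<inter> C \<noteq> {}"
  shows "S \<subseteq> C"
  using connected_components_of_maximal[OF assms(1)] assms(2-4)
  by (auto simp: connectedin_subtopology disjnt_def)

lemma openin_hat_Inl:
  assumes "openin mt V"
  shows "openin X (Inl ` V)"
  unfolding hat_metric_topology_def
  using assms openin_subset[OF assms] by (intro openin_topology_with_subbasis) auto

lemma openin_hat_component:
  assumes "p \<in> mspace T" "C \<in> comps p"
  shows "openin X (hat_component T Tbar i C)"
  unfolding hat_metric_topology_def
  using assms comps_subset[OF assms(2)]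
  by (intro openin_topology_with_subbasis) (auto simp: hat_component_def hat_def)

lemma connectedin_gm:
  assumes "R \<in> H" "is_interval J" "J \<subseteq> extent R"
  shows "connectedin mt (gm R ` J)"
  using isometric_on_connectedin[OF isometric_on_gm[OF assms(1)] assms(2,3)] .

text \<open>The path from \<open>x\<close> through the branch point to \<open>y\<close> stays within
  distance \<open>d x y\<close> of \<open>x\<close>. If \<open>y\<close> is closer to
  \<open>x\<close> than \<open>i p\<close> is, the path avoids \<open>i p\<close> and joins
  \<open>y\<close> to \<open>x\<close> inside the component.\<close>

lemma openin_comps:
  assumes p: "p \<in> mspace T" and C: "C \<in> comps p"
  shows "openin mt C"
  unfolding openin_mtopology_of_iff
proof (intro conjI ballI)
  show "C \<subseteq> M" using comps_subset[OF C] by blast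
  fix x assume x: "x \<in> C"
  have "x \<in> M" "x \<noteq> i p" using comps_subset[OF C] x by auto
  have "y \<in> C" if y: "y \<in> M" "d x y < d x (i p)" for y
  proof -
    define g where "g = gp x y"
    have g: "0 \<le> g" "g \<le> nm x" "g \<le> nm y"
      using gp_nonneg[of x y] gp_le[of x y] gp_le[of y x] \<open>x \<in> M\<close> y
      unfolding g_def by (auto simp: gp_commute)
    have "seg x g = seg y g"
      using seg_agree_iff[of x y g] g \<open>x \<in> M\<close> y unfolding g_def by simp
    define S where "S = seg x ` {g..nm x} \<union> seg y ` {g..nm y}"
    have "connectedin mt (seg x ` {g..nm x})" "connectedin mt (seg y ` {g..nm y})"
      using connectedin_gm[of "Inl x" "{g..nm x}"] connectedin_gm[of "Inl y" "{g..nm y}"] \<open>x \<in> M\<close> y g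
      by auto
    moreover have "seg x ` {g..nm x} \<inter> seg y ` {g..nm y} \<noteq> {}"
      using \<open>seg x g = seg y g\<close> g by (metis IntI atLeastAtMost_iff empty_iff imageI order_refl)
    ultimately have "connectedin mt S"
      unfolding S_def by (rule connectedin_Un)
    have near: "d x (seg x s) \<le> d x y" if "s \<in> {g..nm x}" for s
      using seg[of x s] that g \<open>x \<in> M\<close> y gp_ge[of x y] unfolding g_def by (simp add: B.commute)
    have near': "d x (seg y s) \<le> d x y" if "s \<in> {g..nm y}" for s
    proof -
      have "d x (seg y s) \<le> d x (seg x g) + d (seg y g) (seg y s)"
        using B.triangle[of x "seg x g" "seg y s"] seg[of x g] seg[of y s] that g \<open>x \<in> M\<close> y
          \<open>seg x g = seg y g\<close> by simp
      also have "\<dots> = (nm x - g) + (s - g)"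
        using seg[of x g] gm_dist[of "Inl y" g s] that g \<open>x \<in> M\<close> y by (simp add: B.commute)
      also have "\<dots> \<le> d x y"
        using that unfolding g_def gp_def by (simp add: field_simps)
      finally show ?thesis .
    qed
    have "S \<subseteq> M - {i p}"
    proof
      fix z assume "z \<in> S"
      then have "z \<in> M \<and> d x z \<le> d x y"
        using near near' seg(1)[OF \<open>x \<in> M\<close>] seg(1)[OF y(1)] g(1) unfolding S_def by auto
      then show "z \<in> M - {i p}" using y(2) by auto
    qed
    moreover have "x \<in> S" "y \<in> S"
      using g seg_nm[OF \<open>x \<in> M\<close>] seg_nm[OF y(1)] unfolding S_def
      by (metis UnI1 UnI2 atLeastAtMost_iff imageI order_refl)+
    ultimately show ?thesis
      using comps_maximal[OF C \<open>connectedin mt S\<close>] x by blast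
  qed
  then show "\<exists>r>0. \<forall>y\<in>M. d x y < r \<longrightarrow> y \<in> C"
    using \<open>x \<in> M\<close> \<open>x \<noteq> i p\<close> p by (intro exI[of _ "d x (i p)"]) simp
qed

lemma continuous_map_Inl: "continuous_map mt X Inl"
  unfolding hat_metric_topology_def topology_with_subbasis_def
proof (rule continuous_map_into_topology_subbase)
  fix S assume "S \<in> {Inl ` V |V. openin mt V} \<union>
    {hat_component T Tbar i C |P C. P \<in> mspace T \<and> C \<in> comps P}"
  then consider V where "openin mt V" "S = Inl ` V"
    | p C where "p \<in> mspace T" "C \<in> comps p" "S = hat_component T Tbar i C"
    by blast
  then show "openin mt {x \<in> topspace mt. Inl x \<in> S}"
  proof cases
    case 1
    then have "{x \<in> topspace mt. Inl x \<in> S} = V" using openin_subset[of mt V] by auto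
    then show ?thesis using 1 by simp
  next
    case 2
    then have "{x \<in> topspace mt. Inl x \<in> S} = C"
      using comps_subset[of C p] by (auto simp: hat_component_def)
    then show ?thesis using openin_comps 2 by simp
  qed
qed simp

text \<open>Passes from an arbitrary representative to the ray from \<open>b\<close>: if the latter
  avoided \<open>C\<close> after time \<open>N\<close>, then \<open>\<rho>\<close> could meet
  \<open>C\<close> only in an initial piece, which is compact.\<close>

lemma ray_meets:
  assumes "\<eta> \<in> gromov_boundary T" "\<rho> \<in> \<eta>"
    and nc: "\<not> (\<exists>K. compactin mt K \<and> i ` \<rho> ` {0..} \<inter> C \<subseteq> K)"
  shows "\<exists>u>N. 0 \<le> u \<and> gm (Inr \<eta>) u \<in> C"
proof (rule ccontr)
  assume "\<not> ?thesis"
  then have no: "gm (Inr \<eta>) u \<notin> C" if "N < u" "0 \<le> u" for u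
    using that by blast
  interpret A: Metric_space "mspace T" "mdist T" by (rule Metric_space_mspace_mdist)
  have eq: "(rep \<eta>, \<rho>) \<in> ray_equiv T" using class_rep assms by blast
  then have \<rho>: "\<rho> \<in> rays T" unfolding ray_equiv_def by simp
  obtain r where r: "\<And>x. r < mdist T b x \<Longrightarrow> x \<in> rep \<eta> ` {0..} \<longleftrightarrow> x \<in> \<rho> ` {0..}"
    using ray_equiv_far[OF eq] by blast
  \<comment> \<open>Later than \<open>m\<close>, the ray \<open>\<rho>\<close> is farther than
    \<open>N\<close> and \<open>r\<close> from \<open>b\<close>, so its points lie on the ray from
    \<open>b\<close> at times beyond \<open>N\<close>.\<close>
  define m where "m = max N r + mdist T b (\<rho> 0)"
  have "compactin mt ((i \<circ> \<rho>) ` {0..m})"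
    using \<rho> isometric_on_i unfolding rays_def by (intro isometric_on_compactin[of "{0..}"]) auto
  moreover have "i ` \<rho> ` {0..} \<inter> C \<subseteq> (i \<circ> \<rho>) ` {0..m}"
  proof
    fix x assume "x \<in> i ` \<rho> ` {0..} \<inter> C"
    then obtain v where v: "0 \<le> v" "x = i (\<rho> v)" "x \<in> C" by auto
    have "v \<le> m"
    proof (rule ccontr)
      assume "\<not> v \<le> m"
      moreover have "v - mdist T b (\<rho> 0) \<le> mdist T b (\<rho> v)"
        using A.triangle[of "\<rho> 0" b "\<rho> v"] raysD[OF \<rho>, of 0 v] raysD[OF \<rho>, of v 0] v(1) base
        by (simp add: A.commute)
      ultimately have far: "max N r < mdist T b (\<rho> v)"
        unfolding m_def by linarith
      then obtain u where u: "0 \<le> u" "\<rho> v = rep \<eta> u"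
        using r[of "\<rho> v"] v(1) by auto
      then have "mdist T b (\<rho> v) = u"
        using raysD(2)[OF rep(1)[OF assms(1)], of 0 u] rep(2)[OF assms(1)] by simp
      then show False
        using no[of u] u v far by simp
    qed
    then show "x \<in> (i \<circ> \<rho>) ` {0..m}" using v by auto
  qed
  ultimately show False using nc by blast
qed

text \<open>Time along the ray is the distance from the base point, so after time
  \<open>nm (i p)\<close> the ray does not meet \<open>i p\<close>. The connected tail stays in one
  component.\<close>

lemma ray_tail_subset:
  assumes "\<xi> \<in> gromov_boundary T" "p \<in> mspace T" "C \<in> comps p" "nm (i p) \<le> s"
    "s < u" "gm (Inr \<xi>) u \<in> C" "s < v"
  shows "gm (Inr \<xi>) v \<in> C"
proof -
  have "0 \<le> s" using B.nonneg[of "i b" "i p"] assms(4) by linarith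
  then have "connectedin mt (gm (Inr \<xi>) ` {s<..})"
    using assms(1) by (intro connectedin_gm) auto
  moreover have "gm (Inr \<xi>) ` {s<..} \<subseteq> M - {i p}"
  proof
    fix x assume "x \<in> gm (Inr \<xi>) ` {s<..}"
    then obtain w where "s < w" "x = gm (Inr \<xi>) w" by blast
    then show "x \<in> M - {i p}"
      using gm_in[of "Inr \<xi>" w] nm_gm[of "Inr \<xi>" w] assms(1,4) \<open>0 \<le> s\<close> by auto
  qed
  ultimately show ?thesis
    using comps_maximal[OF assms(3)] assms(5-7) by blast
qed

text \<open>Attaches a boundary point to its ray; both the connectedness of directions and the
  density of the completion rest on it.\<close>

lemma ray_limit:
  assumes \<xi>: "\<xi> \<in> gromov_boundary T"
  shows "limitin X (\<lambda>u. Inl (gm (Inr \<xi>) u)) (Inr \<xi>) at_top"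
  unfolding hat_metric_topology_def
proof (rule limitin_topology_with_subbasis)
  show "eventually (\<lambda>u. Inl (gm (Inr \<xi>) u) \<in> H) at_top"
    using gm_in[of "Inr \<xi>"] \<xi> by (intro eventually_mono[OF eventually_ge_at_top[of 0]]) auto
  fix S assume "S \<in> {Inl ` V |V. openin mt V} \<union>
    {hat_component T Tbar i C |P C. P \<in> mspace T \<and> C \<in> comps P}" "Inr \<xi> \<in> S"
  then obtain p C where C: "p \<in> mspace T" "C \<in> comps p" "S = hat_component T Tbar i C"
    by blast
  then obtain \<rho> where "\<rho> \<in> \<xi>" "\<not> (\<exists>K. compactin mt K \<and> i ` \<rho> ` {0..} \<inter> C \<subseteq> K)"
    using \<open>Inr \<xi> \<in> S\<close> by (auto simp: hat_component_def)
  then obtain u where "nm (i p) < u" "gm (Inr \<xi>) u \<in> C"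
    using ray_meets[OF \<xi>] by metis
  then have "gm (Inr \<xi>) v \<in> C" if "nm (i p) < v" for v
    using ray_tail_subset[OF \<xi> C(1,2) order_refl] that by blast
  then have "Inl (gm (Inr \<xi>) v) \<in> S" if "nm (i p) < v" for v
    using that C(3) unfolding hat_component_def by blast
  then show "eventually (\<lambda>u. Inl (gm (Inr \<xi>) u) \<in> S) at_top"
    by (intro eventually_mono[OF eventually_gt_at_top[of "nm (i p)"]])
qed (use \<xi> in simp)

section \<open>Openness and connectedness of directions\<close>

lemma below_Inl_iff:
  assumes "p \<in> M" "x \<in> M"
  shows "below (Inl p) (Inl x) \<longleftrightarrow> nm p + d p x = nm x"
proof
  assume "below (Inl p) (Inl x)"
  then have "agree (Inl p) (Inl x) (nm p)"
    unfolding below_def by simp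
  then show "nm p + d p x = nm x"
    using seg[of x "nm p"] assms unfolding agree_def by simp
next
  assume *: "nm p + d p x = nm x"
  then have le: "nm p \<le> nm x" using B.nonneg[of p x] by linarith
  have "seg x (nm p) = p"
    using * assms by (intro seg_eqI) auto
  then have "seg p t = seg x t" if "0 \<le> t" "t \<le> nm p" for t
    using seg_seg[of x t "nm p"] that le assms by simp
  then show "below (Inl p) (Inl x)"
    using le unfolding below_def agree_def by auto
qed

lemma not_below_Inr: "\<not> below (Inr \<xi>) (Inl x)"
proof
  assume "below (Inr \<xi>) (Inl x)"
  moreover have "nm x + 1 \<in> extent (Inr \<xi>)" by simp
  ultimately show False
    unfolding below_def agree_def by fastforce
qed

text \<open>Openness comes first inside the completion only. It is needed there to locate the
  components that form the neighbourhoods of boundary points.\<close>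

lemma openin_trace_dirn:
  assumes P: "P \<in> H" and Q: "Q \<in> H"
  shows "openin mt {x \<in> M. Inl x \<in> dirn P Q}"
proof (cases "below P Q")
  case True
  show ?thesis
    unfolding openin_mtopology_of_iff
  proof (intro conjI ballI)
    fix x assume "x \<in> {x \<in> M. Inl x \<in> dirn P Q}"
    then obtain u where x: "x \<in> M" and u: "u \<notin> extent P" "agree (Inl x) Q u"
      using True unfolding dirn_def by auto
    then have "0 \<le> u" "u \<le> nm x" unfolding agree_def by auto
    then obtain p where p: "P = Inl p" "nm p < u" using u by (cases P) auto
    have "Inl y \<in> dirn P Q" if y: "y \<in> M" "d x y < u - nm p" for y
    proof -
      \<comment> \<open>The radius \<open>u - nm p\<close> keeps \<open>gp x y\<close> above
        \<open>nm p\<close>, so \<open>y\<close> agrees with \<open>x\<close> past \<open>P\<close>;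
        capping at \<open>u\<close> preserves the agreement with \<open>Q\<close>.\<close>
      define w where "w = min u (gp x y)"
      have w: "nm p < w" "w \<le> nm x" "w \<le> nm y" "w \<le> u" "w \<le> gp x y"
        using gp_ge[of x y] gp_le[of x y] gp_le[of y x] x y \<open>u \<le> nm x\<close> p(2)
        unfolding w_def by (auto simp: gp_commute)
      have "0 \<le> w" using w(1) B.nonneg[of "i b" p] by linarith
      then have "agree (Inl y) (Inl x) w"
        using seg_agree_iff[of x y w] w x y unfolding agree_def by simp
      moreover have "agree (Inl x) Q w"
        using agree_downward[OF _ Q u(2) \<open>0 \<le> w\<close> \<open>w \<le> u\<close>] x by simp
      ultimately have "agree (Inl y) Q w" by (rule agree_trans)
      moreover have "w \<notin> extent P" using p w by simp
      ultimately show ?thesis using True y unfolding dirn_def by auto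
    qed
    then show "\<exists>r>0. \<forall>y\<in>M. d x y < r \<longrightarrow> y \<in> {x \<in> M. Inl x \<in> dirn P Q}"
      using p by (intro exI[of _ "u - nm p"]) auto
  qed auto
next
  case False
  show ?thesis
  proof (cases P)
    case (Inl p)
    have p: "p \<in> M" using P Inl by simp
    show ?thesis
      unfolding openin_mtopology_of_iff
    proof (intro conjI ballI)
      fix x assume "x \<in> {x \<in> M. Inl x \<in> dirn P Q}"
      then have x: "x \<in> M" "nm p + d p x \<noteq> nm x"
        using False Inl below_Inl_iff[OF p] unfolding dirn_def by auto
      \<comment> \<open>Half the defect in the triangle inequality: moving \<open>x\<close> by less
        than \<open>e\<close> changes the defect by less than \<open>2 * e\<close>, so it stays
        positive.\<close>
      define e where "e = (nm p + d p x - nm x) / 2"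
      have "e > 0"
        using B.triangle[of "i b" p x] x p i_base_in unfolding e_def by simp
      moreover have "Inl y \<in> dirn P Q" if y: "y \<in> M" "d x y < e" for y
      proof -
        have "nm p + d p y \<noteq> nm y"
          using B.triangle[of "i b" x y] B.triangle[of p y x] x y p i_base_in B.commute[of x y]
          unfolding e_def by (auto simp: field_simps)
        then show ?thesis
          using False Inl below_Inl_iff[OF p] y unfolding dirn_def by auto
      qed
      ultimately show "\<exists>r>0. \<forall>y\<in>M. d x y < r \<longrightarrow> y \<in> {x \<in> M. Inl x \<in> dirn P Q}"
        by auto
    qed auto
  next
    case (Inr \<xi>)
    then have "{x \<in> M. Inl x \<in> dirn P Q} = topspace mt"
      using False not_below_Inr unfolding dirn_def by auto
    then show ?thesis by (metis openin_topspace)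
  qed
qed

text \<open>The traces of the directions at \<open>i p\<close> partition the complement of
  \<open>i p\<close> in the completion into open, hence clopen sets, and a connected set lies in a
  single one.\<close>

lemma comps_subset_dirn:
  assumes p: "p \<in> mspace T" and C: "C \<in> comps p" and x: "x \<in> C" and y: "y \<in> C"
  shows "Inl y \<in> dirn (Inl (i p)) (Inl x)"
proof -
  define tr where "tr Q = {y \<in> M. Inl y \<in> dirn (Inl (i p)) Q}" for Q
  define Z where "Z = subtopology mt (M - {i p})"
  have H: "Inl (i p) \<in> H" "Inl x \<in> H" "Inl x \<noteq> Inl (i p)"
    using comps_subset[OF C] x p by auto
  have tr_sub: "tr Q \<subseteq> M - {i p}" for Q
    using dirn_subset unfolding tr_def by blast
  have open_tr: "openin Z (tr Q)" if "Q \<in> H" for Q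
    using openin_trace_dirn[OF H(1) that, folded tr_def] tr_sub[of Q]
    unfolding Z_def openin_subtopology by (metis inf.absorb1)
  define N where "N = H - {Inl (i p)} - dirn (Inl (i p)) (Inl x)"
  note N = dirn_union[OF H(1,2), folded N_def]
  have "Inl y \<in> N \<longleftrightarrow> (\<exists>Q\<in>N. Inl y \<in> dirn (Inl (i p)) Q)" for y
    by (subst N) blast
  then have "{y \<in> M. Inl y \<in> N} = \<Union> (tr ` N)"
    unfolding tr_def by auto
  moreover have "topspace Z - tr (Inl x) = {y \<in> M. Inl y \<in> N}"
    unfolding N_def tr_def Z_def by auto
  moreover have "openin Z (\<Union> (tr ` N))"
    using open_tr unfolding N_def by (intro openin_Union) auto
  ultimately have "closedin Z (tr (Inl x))"
    using tr_sub[of "Inl x"] unfolding closedin_def by (simp add: Z_def) blast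
  moreover have "connectedin Z C"
    using connectedin_connected_components_of C unfolding Z_def by blast
  moreover have "x \<in> tr (Inl x)"
    using dirn_self[OF H(1,2)] H unfolding tr_def by auto
  ultimately have "C \<subseteq> tr (Inl x)"
    using connectedin_clopen_cases[of Z C "tr (Inl x)"] open_tr[OF H(2)] x
    by (auto simp: disjnt_iff)
  then show ?thesis using y unfolding tr_def by blast
qed

text \<open>The component that contains the tail of the ray after time \<open>t\<close> supplies the
  neighbourhood. The tail is unbounded, so no compact set contains it.\<close>

lemma boundary_neighbourhood:
  assumes \<xi>: "\<xi> \<in> gromov_boundary T" and t: "0 \<le> t"
  obtains V where "openin X V" "Inr \<xi> \<in> V" "V \<subseteq> dirn (Inl (gm (Inr \<xi>) t)) (Inr \<xi>)"
proof -
  define p where "p = rep \<xi> t"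
  have p: "p \<in> mspace T" "gm (Inr \<xi>) t = i p"
    using raysD(1)[OF rep(1)[OF \<xi>]] t unfolding p_def by auto
  have H: "Inl (i p) \<in> H" "Inr \<xi> \<in> H" using p \<xi> by auto
  have nm_p: "nm (i p) = t"
    using nm_gm[of "Inr \<xi>" t] p \<xi> t by simp
  have below: "below (Inl (i p)) (Inr \<xi>)"
    using truncate(3)[OF H(2), of t] t nm_p p(2) unfolding below_def by simp
  \<comment> \<open>A point of the ray past time \<open>t\<close>, used to name the
    component.\<close>
  define c where "c = gm (Inr \<xi>) (t + 1)"
  have c: "c \<in> M" "nm c = t + 1"
    using gm_in[of "Inr \<xi>" "t + 1"] nm_gm[of "Inr \<xi>" "t + 1"] \<xi> t unfolding c_def by auto
  define C where "C = connected_component_of_set (subtopology mt (M - {i p})) c"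
  have "c \<in> topspace (subtopology mt (M - {i p}))" using c nm_p by auto
  then have C: "C \<in> comps p" "c \<in> C"
    unfolding C_def by (simp_all add: connected_component_in_connected_components_of
        connected_component_of_refl)
  have tail: "gm (Inr \<xi>) u \<in> C" if "t < u" for u
    using ray_tail_subset[OF \<xi> p(1) C(1), of t "t + 1" u] that C(2) nm_p unfolding c_def by simp
  have "agree (Inl c) (Inr \<xi>) (t + 1)"
    using truncate(3)[OF H(2), of "t + 1"] t unfolding c_def by simp
  then have "Inl c \<in> dirn (Inl (i p)) (Inr \<xi>)"
    using below c nm_p unfolding dirn_def by (auto intro!: exI[of _ "t + 1"])
  then have dirn_c: "dirn (Inl (i p)) (Inl c) = dirn (Inl (i p)) (Inr \<xi>)"
    using dirn_eq H by blast
  have Inl_C: "Inl y \<in> dirn (Inl (i p)) (Inr \<xi>)" if "y \<in> C" for y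
    using comps_subset_dirn[OF p(1) C that] dirn_c by simp
  have "\<not> (\<exists>K. compactin mt K \<and> i ` rep \<xi> ` {0..} \<inter> C \<subseteq> K)"
  proof
    assume "\<exists>K. compactin mt K \<and> i ` rep \<xi> ` {0..} \<inter> C \<subseteq> K"
    then obtain K where K: "compactin mt K" "i ` rep \<xi> ` {0..} \<inter> C \<subseteq> K" by blast
    then have "B.mbounded K"
      using B.compactin_imp_mbounded unfolding mtopology_of_def by blast
    then obtain a r where ar: "K \<subseteq> B.mcball a r" unfolding B.mbounded_def by blast
    have bound: "nm x \<le> nm a + r" if "x \<in> K" for x
      using ar that B.triangle[of "i b" a x] i_base_in by fastforce
    define u where "u = max t (nm a + r) + 1"
    have u: "t < u" "nm a + r < u" "0 \<le> u" using t unfolding u_def by auto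
    then have "gm (Inr \<xi>) u \<in> K" using tail[of u] K(2) by auto
    then show False using bound nm_gm[OF H(2), of u] u by fastforce
  qed
  then have "Inr \<xi> \<in> hat_component T Tbar i C"
    using \<xi> rep(3)[OF \<xi>] unfolding hat_component_def by blast
  moreover have "hat_component T Tbar i C \<subseteq> dirn (Inl (i p)) (Inr \<xi>)"
  proof
    fix R assume "R \<in> hat_component T Tbar i C"
    then consider y where "y \<in> C" "R = Inl y"
      | \<eta> \<rho> where "\<eta> \<in> gromov_boundary T" "R = Inr \<eta>" "\<rho> \<in> \<eta>"
        "\<not> (\<exists>K. compactin mt K \<and> i ` \<rho> ` {0..} \<inter> C \<subseteq> K)"
      unfolding hat_component_def by blast
    then show "R \<in> dirn (Inl (i p)) (Inr \<xi>)"
    proof cases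
      case 1
      then show ?thesis using Inl_C by simp
    next
      case 2
      then have R: "R \<in> H" by simp
      obtain u where u: "0 \<le> u" "gm R u \<in> C"
        using ray_meets[OF 2(1,3,4)] 2(2) by metis
      have "u \<in> extent R" using u 2 by simp
      \<comment> \<open>A point of \<open>C\<close> on the geodesic of \<open>R\<close> agrees with
        the ray at a time \<open>w\<close> past \<open>i p\<close>. This time is at most
        \<open>u\<close>, so \<open>R\<close> itself agrees with the ray there.\<close>
      obtain w where w: "w \<notin> extent (Inl (i p))" "agree (Inl (gm R u)) (Inr \<xi>) w"
        using Inl_C[OF u(2)] below unfolding dirn_def by auto
      then have "agree (Inl (gm R u)) R w"
        using truncate(2,3)[OF R \<open>u \<in> extent R\<close>] unfolding agree_def[of _ "Inr \<xi>"] by auto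
      then have "agree R (Inr \<xi>) w"
        using w(2) agree_sym agree_trans by blast
      then show ?thesis using below R w(1) unfolding dirn_def by auto
    qed
  qed
  ultimately show ?thesis
    using that openin_hat_component[OF p(1) C(1)] p(2) by simp
qed

text \<open>Around a point of the completion the trace is an open neighbourhood. Around a boundary
  point \<open>R\<close>, the direction of \<open>R\<close> at a suitable point of its own ray is
  contained in the given one.\<close>

lemma openin_dirn:
  assumes P: "P \<in> H" and Q: "Q \<in> H"
  shows "openin X (dirn P Q)"
  unfolding openin_subopen[of X "dirn P Q"]
proof
  fix R assume R: "R \<in> dirn P Q"
  have RP: "R \<in> H" "R \<noteq> P" using R dirn_subset by auto
  have eq: "dirn P R = dirn P Q" using dirn_eq[OF P Q R] .
  show "\<exists>V. openin X V \<and> R \<in> V \<and> V \<subseteq> dirn P Q"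
  proof (cases R)
    case (Inl x)
    then show ?thesis
      using openin_hat_Inl[OF openin_trace_dirn[OF P Q]] R RP
      by (intro exI[of _ "Inl ` {x \<in> M. Inl x \<in> dirn P Q}"]) auto
  next
    case (Inr \<xi>)
    have \<xi>: "\<xi> \<in> gromov_boundary T" using RP Inr by simp
    have "\<exists>t\<ge>0. dirn (Inl (gm R t)) R \<subseteq> dirn P R"
    proof (cases "below P R")
      case True
      have "P = Inl (gm R t)" if "P = Inl p" "t = nm p" for p t
      proof -
        have "p \<in> M" "agree P R (nm p)" using True P that(1) unfolding below_def by auto
        then show ?thesis using seg_nm[of p] that unfolding agree_def by simp
      qed
      \<comment> \<open>A boundary point below a boundary point would be equal to it.\<close>
      moreover have "\<exists>p. P = Inl p"
      proof (rule ccontr)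
        assume "\<nexists>p. P = Inl p"
        then obtain \<zeta> where "P = Inr \<zeta>" by (cases P) auto
        then have "below R P"
          using True Inr agree_sym unfolding below_def by simp
        then show False using below_antisym P RP True by blast
      qed
      ultimately show ?thesis by (metis B.nonneg order_refl)
    next
      case False
      \<comment> \<open>Sharing the ray of \<open>R\<close> past time \<open>s\<close> means
        disagreeing with \<open>P\<close> at time \<open>s\<close>, so such points are not beyond
        \<open>P\<close> either.\<close>
      then obtain s where s: "s \<in> extent P" "\<not> agree P R s" unfolding below_def by blast
      have "0 \<le> s" using s(1) extent_nonneg by blast
      then have "s \<in> extent R" using Inr by simp
      note cut = truncate[OF RP(1) this]
      have "below (Inl (gm R s)) R" using cut(2,3) unfolding below_def by simp
      then have "\<not> below P S" if S: "S \<in> dirn (Inl (gm R s)) R" for S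
      proof -
        obtain u where u: "S \<in> H" "agree S R u" "u \<notin> {0..s}"
          using S \<open>below (Inl (gm R s)) R\<close> cut(2) unfolding dirn_def by auto
        then have "s \<le> u" using extent_nonneg[of u S] unfolding agree_def by auto
        then have "agree S R s" using agree_downward[OF u(1) RP(1) u(2) \<open>0 \<le> s\<close>] by simp
        then show ?thesis using s agree_trans unfolding below_def by blast
      qed
      then have "dirn (Inl (gm R s)) R \<subseteq> dirn P R"
        using False dirn_subset unfolding dirn_def[of P] by auto
      then show ?thesis using \<open>0 \<le> s\<close> by blast
    qed
    then show ?thesis
      using boundary_neighbourhood[OF \<xi>] Inr eq by (metis subset_trans)
  qed
qed

text \<open>\<open>J\<close> is a final part of the geodesic. A point of the completion is already
  its end point; a boundary point lies in its closure, and adding points of the closure preserves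
  connectedness.\<close>

lemma connectedin_ray:
  assumes R: "R \<in> H" and J: "is_interval J" "J \<subseteq> extent R" "J \<noteq> {}"
    and up: "\<And>s t. s \<in> J \<Longrightarrow> t \<in> extent R \<Longrightarrow> s \<le> t \<Longrightarrow> t \<in> J"
  shows "connectedin X (insert R (Inl ` gm R ` J))"
proof -
  obtain s where s: "s \<in> J" using J(3) by blast
  have conn: "connectedin X (Inl ` gm R ` J)"
    by (rule connectedin_continuous_map_image[OF continuous_map_Inl connectedin_gm[OF R J(1,2)]])
  show ?thesis
  proof (cases R)
    case (Inl x)
    then have "nm x \<in> J" "x \<in> M" using up[OF s, of "nm x"] s J(2) R by auto
    then have "R \<in> Inl ` gm R ` J"
      using Inl seg_nm[of x] by (metis gm_simps(1) imageI)
    then show ?thesis using conn by (simp add: insert_absorb)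
  next
    case (Inr \<xi>)
    then have \<xi>: "\<xi> \<in> gromov_boundary T" using R by simp
    have "R \<in> X closure_of (Inl ` gm R ` J)"
      unfolding in_closure_of
    proof (intro conjI allI impI)
      fix V assume "R \<in> V \<and> openin X V"
      then have "eventually (\<lambda>u. Inl (gm R u) \<in> V) at_top"
        using ray_limit[OF \<xi>] Inr unfolding limitin_def by blast
      then obtain u where "s \<le> u" "Inl (gm R u) \<in> V"
        unfolding eventually_at_top_linorder by (metis max.cobounded1 max.cobounded2)
      moreover have "u \<in> J"
        using up[OF s, of u] \<open>s \<le> u\<close> s J(2) Inr by auto
      ultimately show "\<exists>y. y \<in> Inl ` gm R ` J \<and> y \<in> V" by blast
    qed (use R in simp)
    then show ?thesis
      using conn closure_of_subset[of "Inl ` gm R ` J" X] connectedin_subset_topspace[OF conn]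
      by (intro connectedin_intermediate_closure_of[OF conn]) auto
  qed
qed

text \<open>Each point is joined to \<open>Q\<close> within the direction. If \<open>P\<close> is
  below \<open>Q\<close>, the parts of the two geodesics past \<open>P\<close> are used, which share
  the point at time \<open>u\<close>; otherwise the whole geodesics, which share the base
  point.\<close>

lemma connectedin_dirn:
  assumes P: "P \<in> H" and Q: "Q \<in> H" and "P \<noteq> Q"
  shows "connectedin X (dirn P Q)"
proof (rule connectedin_star[of Q])
  show "Q \<in> dirn P Q" using dirn_self assms by blast
  fix R assume R: "R \<in> dirn P Q"
  then have "R \<in> H" using dirn_subset by blast
  show "\<exists>S. connectedin X S \<and> Q \<in> S \<and> R \<in> S \<and> S \<subseteq> dirn P Q"
  proof (cases "below P Q")
    case True
    define S where "S R = insert R (Inl ` gm R ` (extent R - extent P))" for R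
    obtain u where u: "u \<notin> extent P" "agree R Q u"
      using R True unfolding dirn_def by auto
    have S: "connectedin X (S R)" "S R \<subseteq> dirn P Q" if R: "R \<in> dirn P Q" for R
    proof -
      have "R \<in> H" using R dirn_subset by blast
      obtain w where w: "w \<notin> extent P" "agree R Q w"
        using R True unfolding dirn_def by auto
      show "connectedin X (S R)"
        unfolding S_def
      proof (rule connectedin_ray[OF \<open>R \<in> H\<close>])
        show "is_interval (extent R - extent P)"
          unfolding is_interval_1
          by (meson DiffD1 DiffD2 DiffI extent_downward extent_nonneg order_trans)
        show "extent R - extent P \<noteq> {}" using w unfolding agree_def by blast
        show "t \<in> extent R - extent P" if "s \<in> extent R - extent P" "t \<in> extent R" "s \<le> t" for s t
          using that extent_downward[of t P s] extent_nonneg[of s R] by blast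
      qed auto
      show "S R \<subseteq> dirn P Q"
      proof
        fix Z assume "Z \<in> S R"
        then consider "Z = R" | v where "v \<in> extent R" "v \<notin> extent P" "Z = Inl (gm R v)"
          unfolding S_def by blast
        then show "Z \<in> dirn P Q"
        proof cases
          case 2
          note cut = truncate[OF \<open>R \<in> H\<close> 2(1)]
          have "agree Z R v" using cut(3)[of v] extent_nonneg[OF 2(1)] 2(3) by simp
          then show ?thesis
            using agree_trans_min[OF _ \<open>R \<in> H\<close> Q _ w(2) 2(2) w(1)] cut(1) 2(3) True
            unfolding dirn_def by auto
        qed (use R in simp)
      qed
    qed
    have "gm R u \<in> gm R ` (extent R - extent P)" "gm R u \<in> gm Q ` (extent Q - extent P)"
      using u unfolding agree_def by blast+
    then have "Inl (gm R u) \<in> S R \<inter> S Q"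
      unfolding S_def by blast
    then have "connectedin X (S R \<union> S Q)"
      using S(1)[OF R] S(1)[OF \<open>Q \<in> dirn P Q\<close>] by (intro connectedin_Un) auto
    then show ?thesis
      using S(2)[OF R] S(2)[OF \<open>Q \<in> dirn P Q\<close>]
      by (intro exI[of _ "S R \<union> S Q"]) (auto simp: S_def)
  next
    case False
    define S where "S R = insert R (Inl ` gm R ` extent R)" for R
    have S: "connectedin X (S R)" "S R \<subseteq> dirn P Q" "Inl (i b) \<in> S R" if R: "R \<in> dirn P Q" for R
    proof -
      have R': "R \<in> H" "\<not> below P R" using R False unfolding dirn_def by auto
      show "connectedin X (S R)"
        unfolding S_def
      proof (rule connectedin_ray[OF R'(1) is_interval_extent])
        show "extent R \<noteq> {}" using zero_in_extent[of R] by blast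
      qed auto
      show "Inl (i b) \<in> S R"
        using gm_0[OF R'(1)] zero_in_extent[of R] unfolding S_def by (metis imageI insertI2)
      show "S R \<subseteq> dirn P Q"
      proof
        fix Z assume "Z \<in> S R"
        then consider "Z = R" | v where "v \<in> extent R" "Z = Inl (gm R v)"
          unfolding S_def by blast
        then show "Z \<in> dirn P Q"
        proof cases
          case 2
          note cut = truncate[OF R'(1) 2(1)]
          have "\<not> below P Z"
          proof
            assume "below P Z"
            moreover have "below Z R"
              using cut(2,3) 2(2) unfolding below_def by simp
            ultimately show False using R'(2) below_trans by blast
          qed
          then show ?thesis using cut(1) 2(2) False unfolding dirn_def by simp
        qed (use R in simp)
      qed
    qed
    have "connectedin X (S R \<union> S Q)"
      using S[OF R] S[OF \<open>Q \<in> dirn P Q\<close>] by (intro connectedin_Un) auto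
    then show ?thesis
      using S(2)[OF R] S(2)[OF \<open>Q \<in> dirn P Q\<close>]
      by (intro exI[of _ "S R \<union> S Q"]) (auto simp: S_def)
  qed
qed

section \<open>The observers' topology\<close>

lemma direction_eq_dirn:
  assumes P: "P \<in> H" and Q: "Q \<in> H" and "P \<noteq> Q"
  shows "direction T Tbar i P Q = dirn P Q"
proof -
  define Z where "Z = subtopology X (H - {P})"
  have open_Z: "openin Z (dirn P R)" if "R \<in> H" for R
    using openin_dirn[OF P that] dirn_subset[of P R] unfolding Z_def openin_subtopology
    by (metis inf.absorb1)
  have "openin Z (\<Union> {dirn P R |R. R \<in> H - {P} - dirn P Q})"
    using open_Z by (intro openin_Union) auto
  then have closed: "closedin Z (dirn P Q)"
    using dirn_union[OF P Q] dirn_subset[of P Q] unfolding closedin_def Z_def by (auto simp: Int_absorb1)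
  have "connected_component_of_set Z Q = dirn P Q"
  proof (rule connected_component_of_unique)
    show "Q \<in> dirn P Q" using dirn_self assms by blast
    show "connectedin Z (dirn P Q)"
      unfolding Z_def connectedin_subtopology using connectedin_dirn assms dirn_subset by blast
    show "C \<subseteq> dirn P Q" if "Q \<in> C \<and> connectedin Z C" for C
      using connectedin_clopen_cases[of Z C, OF _ closed open_Z[OF Q]] that \<open>Q \<in> dirn P Q\<close>
      by (auto simp: disjnt_iff)
  qed
  then show ?thesis unfolding direction_def Z_def .
qed

lemma observers_topology_eq:
  "observers_topology T Tbar i =
     topology_with_subbasis H {dirn P Q |P Q. P \<in> H \<and> Q \<in> H \<and> P \<noteq> Q}"
proof -
  have "{direction T Tbar i P Q |P Q. P \<in> H \<and> Q \<in> H \<and> P \<noteq> Q} =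
    {dirn P Q |P Q. P \<in> H \<and> Q \<in> H \<and> P \<noteq> Q}"
    using direction_eq_dirn by (auto; metis)
  then show ?thesis unfolding observers_topology_def by simp
qed

lemma openin_observers_dirn:
  assumes "P \<in> H" "Q \<in> H" "P \<noteq> Q"
  shows "openin (observers_topology T Tbar i) (dirn P Q)"
  unfolding observers_topology_eq using assms dirn_subset[of P Q]
  by (intro openin_topology_with_subbasis) auto

lemma openin_observers_imp_hat:
  assumes "openin (observers_topology T Tbar i) W"
  shows "openin X W"
proof (rule minimal_topology_subbase)
  show "openin (topology (arbitrary union_of (finite intersection_of
      (\<lambda>S. S \<in> {dirn P Q |P Q. P \<in> H \<and> Q \<in> H \<and> P \<noteq> Q}) relative_to H))) W"
    using assms unfolding observers_topology_eq topology_with_subbasis_def .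
  show "openin X H" using openin_topspace[of X] by simp
qed (use openin_dirn in auto)

lemma Hausdorff_observers: "Hausdorff_space (observers_topology T Tbar i)"
  unfolding Hausdorff_space_def
proof (intro allI impI)
  fix P Q assume "P \<in> topspace (observers_topology T Tbar i) \<and>
    Q \<in> topspace (observers_topology T Tbar i) \<and> P \<noteq> Q"
  then have PQ: "P \<in> H" "Q \<in> H" "P \<noteq> Q" unfolding observers_topology_eq by auto
  obtain R where R: "R \<in> H" "P \<noteq> R" "Q \<noteq> R" "dirn R P \<inter> dirn R Q = {}"
    using Hausdorff_separation[OF PQ] .
  then show "\<exists>U V. openin (observers_topology T Tbar i) U \<and>
      openin (observers_topology T Tbar i) V \<and> P \<in> U \<and> Q \<in> V \<and> disjnt U V"
    using openin_observers_dirn[OF R(1) PQ(1)] openin_observers_dirn[OF R(1) PQ(2)]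
      dirn_self[OF R(1) PQ(1)] dirn_self[OF R(1) PQ(2)]
    by (intro exI[of _ "dirn R P"] exI[of _ "dirn R Q"]) (auto simp: disjnt_def)
qed

lemma compact_observers: "compact_space (observers_topology T Tbar i)"
proof (cases "\<exists>P\<in>H. \<exists>Q\<in>H. P \<noteq> Q")
  case True
  show ?thesis
  proof (rule Alexander_subbase_alt)
    show "topology (arbitrary union_of (finite intersection_of
      (\<lambda>S. S \<in> {dirn P Q |P Q. P \<in> H \<and> Q \<in> H \<and> P \<noteq> Q}) relative_to H)) = observers_topology T Tbar i"
      unfolding observers_topology_eq topology_with_subbasis_def ..
    show "H \<subseteq> \<Union> {dirn P Q |P Q. P \<in> H \<and> Q \<in> H \<and> P \<noteq> Q}"
    proof
      fix R assume "R \<in> H"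
      then obtain P where "P \<in> H" "P \<noteq> R" using True by metis
      then show "R \<in> \<Union> {dirn P Q |P Q. P \<in> H \<and> Q \<in> H \<and> P \<noteq> Q}"
        using dirn_self[of P R] \<open>R \<in> H\<close> by blast
    qed
  qed (rule finite_subcover_of_directions)
next
  \<comment> \<open>A one-point space has no directions. The subbasis then does not cover it, and
    Alexander's theorem does not apply.\<close>
  case False
  moreover have "Inl (i b) \<in> H" using i_base_in by simp
  ultimately have "H \<subseteq> {Inl (i b)}" by blast
  then have "finite (topspace (observers_topology T Tbar i))"
    unfolding observers_topology_eq using finite_subset by auto
  then show ?thesis by (simp add: compact_space_def finite_imp_compactin_eq)
qed

lemma separable_observers:
  assumes "separable_space (mtopology_of T)"
  shows "separable_space (observers_topology T Tbar i)"
proof -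
  interpret A: Metric_space "mspace T" "mdist T" by (rule Metric_space_mspace_mdist)
  obtain D where D: "countable D" "D \<subseteq> mspace T" "mtopology_of T closure_of D = mspace T"
    using assms unfolding separable_space_def by auto
  have meets: "\<exists>c\<in>D. Inl (i c) \<in> W" if W: "openin X W" and x: "x \<in> M" "Inl x \<in> W" for W x
  proof -
    have "openin mt {x \<in> M. Inl x \<in> W}"
      using openin_continuous_map_preimage[OF continuous_map_Inl W] by simp
    then obtain e where e: "e > 0" "\<forall>y\<in>M. d x y < e \<longrightarrow> Inl y \<in> W"
      using x unfolding openin_mtopology_of_iff by blast
    \<comment> \<open>Two approximations, from the completion to \<open>T\<close> and from
      \<open>T\<close> to \<open>D\<close>, each within \<open>e / 2\<close>.\<close>
    obtain y where y: "y \<in> mspace T" "d x (i y) < e / 2"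
      using dense[OF x(1), of "e / 2"] e(1) by auto
    have "y \<in> A.mtopology closure_of D"
      using D(3) y(1) unfolding mtopology_of_def by simp
    then have "\<exists>c\<in>D. c \<in> A.mball y (e / 2)"
      unfolding A.metric_closure_of using half_gt_zero[OF e(1)] by blast
    then obtain c where c: "c \<in> D" "mdist T y c < e / 2"
      by auto
    have "d x (i c) < e"
      using B.triangle[of x "i y" "i c"] x y c D(2) by auto
    moreover have "i c \<in> M" using c(1) D(2) by auto
    ultimately show ?thesis using e(2) c(1) by blast
  qed
  have "observers_topology T Tbar i closure_of (Inl ` i ` D) = H"
  proof
    show "observers_topology T Tbar i closure_of (Inl ` i ` D) \<subseteq> H"
      using closure_of_subset_topspace[of "observers_topology T Tbar i"]
      unfolding observers_topology_eq by simp
    show "H \<subseteq> observers_topology T Tbar i closure_of (Inl ` i ` D)"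
    proof
      fix R assume R: "R \<in> H"
      have "\<exists>y. y \<in> Inl ` i ` D \<and> y \<in> W" if "R \<in> W \<and> openin (observers_topology T Tbar i) W" for W
      proof -
        have W: "R \<in> W" "openin X W" using that openin_observers_imp_hat by auto
        \<comment> \<open>An open set around a boundary point contains points of its ray, which
          reduces density to the completion.\<close>
        have "\<exists>x\<in>M. Inl x \<in> W"
        proof (cases R)
          case (Inr \<xi>)
          then have "eventually (\<lambda>u. Inl (gm (Inr \<xi>) u) \<in> W) at_top"
            using ray_limit[of \<xi>] R W unfolding limitin_def by auto
          then obtain u where "Inl (gm (Inr \<xi>) u) \<in> W"
            unfolding eventually_at_top_linorder by blast
          moreover from this have "gm (Inr \<xi>) u \<in> M" using openin_subset[OF W(2)] by auto
          ultimately show ?thesis by blast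
        qed (use R W in auto)
        then show ?thesis using meets[OF W(2)] by blast
      qed
      then show "R \<in> observers_topology T Tbar i closure_of (Inl ` i ` D)"
        using R unfolding in_closure_of by (simp add: observers_topology_eq)
    qed
  qed
  then show ?thesis
    unfolding separable_space_def using D(1,2)
    by (intro exI[of _ "Inl ` i ` D"]) (auto simp: observers_topology_eq)
qed

end

theorem proposition1p13:
  fixes T :: "'a metric" and Tbar :: "'b metric" and i :: "'a \<Rightarrow> 'b"
  assumes "real_tree T"
    and "metric_completion_of T Tbar i"
  shows "Hausdorff_space (observers_topology T Tbar i) \<and>
    (separable_space (mtopology_of T) \<longrightarrow>
       separable_space (observers_topology T Tbar i) \<and>
       compact_space (observers_topology T Tbar i))"
proof (cases "mspace T = {}")
  \<comment> \<open>Without points there is no base point, but then there are no rays either and the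
    whole space is empty.\<close>
  case True
  then have "mspace Tbar = {}"
    using assms(2) unfolding metric_completion_of_def by (metis closure_of_empty image_empty)
  moreover have "rays T = {}"
    using True unfolding rays_def isometric_on_def by auto
  ultimately have "topspace (observers_topology T Tbar i) = {}"
    unfolding observers_topology_def hat_def gromov_boundary_def by (simp add: quotient_def)
  then show ?thesis
    by (simp add: Hausdorff_space_def separable_space_def compact_space_def)
next
  case False
  then obtain b where "b \<in> mspace T" by blast
  then interpret completed_tree T Tbar i b
    using assms by unfold_locales
  show ?thesis
    using Hausdorff_observers compact_observers separable_observers by blast
qed

end
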